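(* Let $t_0\in\mathbb{R}$, $T\in(\mathbb{R}\setminus\{t_0\})\cup\{\pm\infty\}$, let $\mathcal{P}$ be the open segment of the real axis between $t_0$ and $T$, and let $\phi:\mathcal{P}\to(0,\infty)$ and $a:\mathcal{P}\to\mathbb{C}$ be continuous. Suppose that $\phi(t)>\phi(t_0)\ge0$ for every $t\in\mathcal{P}\cup\{T\}$, and that there is $\lambda_0\ge0$ with $\int_{\mathcal{P}}e^{-\lambda_0\phi(t)}|a(t)|\,dt<\infty$. Define $$\varphi(t):=\bigl(-\log(1-e^{-\phi(t)})\bigr)^{-1}\qquad(t\in\mathcal{P}).$$ If the pair $(a,\varphi)$ satisfies the factorization condition (F) of the context, then, with $\chi_n$, $\operatorname{c}_{\mathcal{P}}(n)$, $\omega_{\mathcal{P}}$ and $\mathcal{M}_{\operatorname{B}}$ as in the context, $$\int_{\mathcal{P}}e^{-\lambda\phi(t)}a(t)\,dt\;\sim\;e^{i\omega_{\mathcal{P}}}\sum_{n=0}^\infty\mathcal{M}_{\operatorname{B}}(\chi_n,\lambda-1)\,\operatorname{c}_{\mathcal{P}}(n)\qquad(\lambda\to\infty).$$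
   Context: Conventions. Integrals over $\mathcal{P}$ are with respect to Lebesgue measure $dt$. For a function $f$ on $\mathcal{P}$ and $\tau\in\{t_0,T\}$, $f(\tau):=\lim_{t\to\tau,\,t\in\mathcal{P}}f(t)$ ($\phi(T)$ may be $+\infty$). $\omega_{\mathcal{P}}:=0$ if $T>t_0$, $\omega_{\mathcal{P}}:=\pi$ if $T<t_0$. $D_R(t_0)=\{t\in\mathbb{C}:|t-t_0|<R\}$, $\mathcal{P}_R:=\mathcal{P}\cap D_R(t_0)$. Condition (F). There exist $R>0$, $\alpha_0\in\mathbb{C}$ with $\Re\alpha_0>-1$, $\beta_0>0$, and analytic functions $q,p:D_R(t_0)\to\mathbb{C}$ with $p(t_0)\ne0$, such that $\varphi(t)>0$ and $$a(t)=(t-t_0)^{\alpha_0}q(t),\qquad\varphi(t)=(t-t_0)^{\beta_0}p(t)\qquad(t\in\mathcal{P}_R),$$ where $(t-t_0)^\gamma=|t-t_0|^\gamma e^{i\gamma\omega_{\mathcal{P}}}$ for $t\in\mathcal{P}_R$. Powers of $p$ use the branch with $\{p(t)\}^\kappa=|p(t)|^\kappa e^{-i\kappa\beta_0\omega_{\mathcal{P}}}$ for $t\in\mathcal{P}_R\cup\{t_0\}$, continued analytically to a neighbourhood of $t_0$. For $n\in\mathbb{N}_0$, $$\chi_n:=\frac{\alpha_0+1+n}{\beta_0},\qquad\operatorname{c}_{\mathcal{P}}(n):=\frac1{\beta_0}\frac1{n!}\frac{d^n}{dw^n}\frac{q(w)}{\{p(w)\}^{\chi_n}}\Big|_{w=t_0}.$$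 Mellin transform of the beta function: for $\lambda>0$ and $0<\Re z<\lambda$, $$\mathcal{M}_{\operatorname{B}}(z,\lambda-1):=\int_0^\infty t^{-z-1}(1-e^{-t})^\lambda\,dt.$$ Meaning of $\sim$: $L(\lambda)\sim\sum_{n\ge0}\Phi_n(\lambda)d_n$ means that for every $N\in\mathbb{N}$, $L(\lambda)-\sum_{n=0}^{N-1}\Phi_n(\lambda)d_n=o(\Phi_{N-1}(\lambda))$ as $\lambda\to\infty$; here $\Phi_n(\lambda)=\mathcal{M}_{\operatorname{B}}(\chi_n,\lambda-1)$. *)

theory Defs
  imports "HOL-Complex_Analysis.Complex_Analysis" "HOL-Library.Landau_Symbols"
begin

definition segm :: "real \<Rightarrow> ereal \<Rightarrow> real set" where
  "segm t0 T = einterval (min (ereal t0) T) (max (ereal t0) T)"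

definition segm_near :: "real \<Rightarrow> ereal \<Rightarrow> real \<Rightarrow> real set" where
  "segm_near t0 T R = segm t0 T \<inter> {t. \<bar>t - t0\<bar> < R}"

(* The filter of t tending to \<tau> inside P; the endpoint \<tau> may be infinite. *)
definition tending_within :: "ereal \<Rightarrow> real set \<Rightarrow> real filter" where
  "tending_within \<tau> P = inf (filtercomap ereal (nhds \<tau>)) (principal P)"

definition omega :: "real \<Rightarrow> ereal \<Rightarrow> real" where
  "omega t0 T = (if T > ereal t0 then 0 else pi)"

(* (t - t0)^\<gamma> for t on the segment *)
definition segm_power :: "real \<Rightarrow> ereal \<Rightarrow> complex \<Rightarrow> real \<Rightarrow> complex" where
  "segm_power t0 T \<gamma> t = of_real \<bar>t - t0\<bar> powr \<gamma> * exp (\<i> * \<gamma> * of_real (omega t0 T))"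

definition factorization ::
  "real \<Rightarrow> ereal \<Rightarrow> (real \<Rightarrow> complex) \<Rightarrow> (real \<Rightarrow> real) \<Rightarrow> real \<Rightarrow> complex \<Rightarrow> real \<Rightarrow>
    (complex \<Rightarrow> complex) \<Rightarrow> (complex \<Rightarrow> complex) \<Rightarrow> bool" where
  "factorization t0 T a \<phi> R \<alpha>0 \<beta>0 q p \<longleftrightarrow>
     R > 0 \<and> Re \<alpha>0 > -1 \<and> \<beta>0 > 0 \<and>
     q analytic_on ball (of_real t0) R \<and> p analytic_on ball (of_real t0) R \<and>
     p (of_real t0) \<noteq> 0 \<and>
     (\<forall>t\<in>segm_near t0 T R.
        \<phi> t > 0 \<and>
        a t = segm_power t0 T \<alpha>0 t * q (of_real t) \<and>
        of_real (\<phi> t) = segm_power t0 T (of_real \<beta>0) t * p (of_real t))"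

definition power_branch ::
  "real \<Rightarrow> ereal \<Rightarrow> real \<Rightarrow> real \<Rightarrow> (complex \<Rightarrow> complex) \<Rightarrow> complex \<Rightarrow> (complex \<Rightarrow> complex) \<Rightarrow> bool" where
  "power_branch t0 T R \<beta>0 p \<kappa> f \<longleftrightarrow>
     f analytic_on {of_real t0} \<and>
     (\<forall>t\<in>insert t0 (segm_near t0 T R).
        f (of_real t) = of_real (cmod (p (of_real t))) powr \<kappa> *
                        exp (- \<i> * \<kappa> * of_real (\<beta>0 * omega t0 T)))"

(* The branch {p(w)}^\<kappa>. Only its germ at t0 is used; the lemmas power_branch_exists and
   power_branch_germ_unique below show that the choice exists and that its germ is unique. *)
definition p_power ::
  "real \<Rightarrow> ereal \<Rightarrow> real \<Rightarrow> real \<Rightarrow> (complex \<Rightarrow> complex) \<Rightarrow> complex \<Rightarrow> complex \<Rightarrow> complex" where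
  "p_power t0 T R \<beta>0 p \<kappa> = (SOME f. power_branch t0 T R \<beta>0 p \<kappa> f)"

definition chi :: "complex \<Rightarrow> real \<Rightarrow> nat \<Rightarrow> complex" where
  "chi \<alpha>0 \<beta>0 n = (\<alpha>0 + 1 + of_nat n) / of_real \<beta>0"

definition c_coeff ::
  "real \<Rightarrow> ereal \<Rightarrow> real \<Rightarrow> complex \<Rightarrow> real \<Rightarrow> (complex \<Rightarrow> complex) \<Rightarrow> (complex \<Rightarrow> complex) \<Rightarrow>
    nat \<Rightarrow> complex" where
  "c_coeff t0 T R \<alpha>0 \<beta>0 q p n =
     1 / of_real \<beta>0 * (1 / fact n) *
     (deriv ^^ n) (\<lambda>w. q w / p_power t0 T R \<beta>0 p (chi \<alpha>0 \<beta>0 n) w) (of_real t0)"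

(* The integral converges for 0 < Re z < \<mu> + 1. *)
definition mellin_beta :: "complex \<Rightarrow> real \<Rightarrow> complex" where
  "mellin_beta z \<mu> =
     (LINT t:{0<..}|lborel. of_real t powr (- z - 1) * of_real ((1 - exp (- t)) powr (\<mu> + 1)))"

definition asymp_expansion ::
  "(real \<Rightarrow> complex) \<Rightarrow> (nat \<Rightarrow> real \<Rightarrow> complex) \<Rightarrow> (nat \<Rightarrow> complex) \<Rightarrow> bool" where
  "asymp_expansion L \<Phi> d \<longleftrightarrow>
     (\<forall>N\<ge>1. (\<lambda>l. L l - (\<Sum>n<N. \<Phi> n l * d n)) \<in> o[at_top](\<Phi> (N - 1)))"

lemma segm_near_islimpt:
  assumes "T \<noteq> ereal t0" "R > 0"
  shows "t0 islimpt segm_near t0 T R"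
proof (cases "T > ereal t0")
  case True
  then obtain s where s: "ereal t0 < ereal s" "ereal s < T"
    using ereal_dense2 by blast
  have sub: "{t0<..<min s (t0 + R)} \<subseteq> segm_near t0 T R"
  proof
    fix x assume x: "x \<in> {t0<..<min s (t0 + R)}"
    then have "ereal x < T" using s(2) by (auto intro: less_trans[of _ "ereal s"])
    then show "x \<in> segm_near t0 T R"
      using x True by (auto simp: segm_near_def segm_def einterval_def min_def max_def split: if_splits)
  qed
  have "t0 islimpt {t0<..<min s (t0 + R)}"
    using s assms by (intro islimpt_greaterThanLessThan1) auto
  then show ?thesis using sub islimpt_subset by blast
next
  case False
  then have lt: "T < ereal t0" using assms by auto
  then obtain s where s: "T < ereal s" "ereal s < ereal t0"
    using ereal_dense2 by blast
  have sub: "{max s (t0 - R)<..<t0} \<subseteq> segm_near t0 T R"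
  proof
    fix x assume x: "x \<in> {max s (t0 - R)<..<t0}"
    then have "T < ereal x" using s(1) by (auto intro: less_trans[of _ "ereal s"])
    then show "x \<in> segm_near t0 T R"
      using x lt by (auto simp: segm_near_def segm_def einterval_def min_def max_def split: if_splits)
  qed
  have "t0 islimpt {max s (t0 - R)<..<t0}"
    using s assms by (intro islimpt_greaterThanLessThan2) auto
  then show ?thesis using sub islimpt_subset by blast
qed

lemma of_real_segm_near_islimpt:
  assumes "T \<noteq> ereal t0" "R > 0"
  shows "(of_real t0 :: complex) islimpt (of_real ` segm_near t0 T R)"
  unfolding islimpt_approachable
proof (intro allI impI)
  fix e :: real assume "e > 0"
  then obtain x where "x \<in> segm_near t0 T R" "x \<noteq> t0" "dist x t0 < e"
    using segm_near_islimpt[OF assms] unfolding islimpt_approachable by blast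
  then show "\<exists>x'\<in>of_real ` segm_near t0 T R. x' \<noteq> (of_real t0 :: complex) \<and> dist x' (of_real t0) < e"
    by (intro bexI[of _ "of_real x"]) (auto simp: dist_of_real)
qed

lemma power_branch_exists:
  assumes "factorization t0 T a \<phi> R \<alpha>0 \<beta>0 q p" and "T \<noteq> ereal t0"
  shows "\<exists>f. power_branch t0 T R \<beta>0 p \<kappa> f"
proof -
  define \<theta> where "\<theta> = \<beta>0 * omega t0 T"
  define g where "g w = p w * cis \<theta>" for w
  define f where "f w = g w powr \<kappa> * exp (- \<i> * \<kappa> * of_real \<theta>)" for w
  have R: "R > 0" and p0: "p (of_real t0) \<noteq> 0"
    and pan: "p analytic_on ball (of_real t0) R"
    using assms(1) by (auto simp: factorization_def)
  have norm_g: "cmod (g w) = cmod (p w)" for w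
    by (simp add: g_def norm_mult)
  have on: "g (of_real t) = of_real (cmod (g (of_real t)))" if t: "t \<in> segm_near t0 T R" for t
  proof -
    have 1: "\<phi> t > 0" and 2: "of_real (\<phi> t) = segm_power t0 T (of_real \<beta>0) t * p (of_real t)"
      using assms(1) t by (auto simp: factorization_def)
    have tt: "t \<noteq> t0" using t
      by (auto simp: segm_near_def segm_def einterval_def min_def max_def split: if_splits)
    have "segm_power t0 T (of_real \<beta>0) t = of_real (\<bar>t - t0\<bar> powr \<beta>0) * cis \<theta>"
      using tt by (simp add: segm_power_def powr_of_real cis_conv_exp \<theta>_def mult_ac)
    with 2 have "of_real (\<phi> t) = of_real (\<bar>t - t0\<bar> powr \<beta>0) * g (of_real t)"
      by (simp add: g_def mult_ac)
    then have "g (of_real t) = of_real (\<phi> t / \<bar>t - t0\<bar> powr \<beta>0)"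
      using tt by (simp add: field_simps)
    then show ?thesis
      using 1 by (simp only: norm_of_real) (simp add: abs_of_pos)
  qed
  have pan0: "p analytic_on {of_real t0}"
    using pan R by (rule_tac analytic_on_subset) auto
  then have gan0: "g analytic_on {of_real t0}"
    unfolding g_def by (intro analytic_intros)
  have "g \<midarrow>of_real t0\<rightarrow> g (of_real t0)"
    using analytic_at_imp_isCont[OF gan0] by (simp add: isCont_def)
  then have lim: "(g \<longlongrightarrow> g (of_real t0)) (at (of_real t0) within (of_real ` segm_near t0 T R))"
    by (rule tendsto_within_subset) auto
  have "((\<lambda>w. g w - of_real (cmod (g w))) \<longlongrightarrow> g (of_real t0) - of_real (cmod (g (of_real t0))))
          (at (of_real t0) within (of_real ` segm_near t0 T R))"
    by (intro tendsto_intros lim)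
  moreover have "((\<lambda>w. g w - of_real (cmod (g w))) \<longlongrightarrow> 0)
          (at (of_real t0) within (of_real ` segm_near t0 T R))"
    by (rule tendsto_eventually) (use on in \<open>auto simp: eventually_at_filter intro!: always_eventually\<close>)
  moreover have "at (of_real t0 :: complex) within (of_real ` segm_near t0 T R) \<noteq> bot"
    using of_real_segm_near_islimpt[OF assms(2) R] trivial_limit_within by blast
  ultimately have "g (of_real t0) - of_real (cmod (g (of_real t0))) = 0"
    using tendsto_unique by blast
  then have at0: "g (of_real t0) = of_real (cmod (g (of_real t0)))" by simp
  have pos0: "cmod (g (of_real t0)) > 0"
    using p0 norm_g by simp
  have "g (of_real t0) \<notin> \<real>\<^sub>\<le>\<^sub>0"
    by (subst at0) (use pos0 in \<open>simp only: nonpos_Reals_of_real_iff not_le\<close>)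
  then have "f analytic_on {of_real t0}"
    unfolding f_def using gan0 by (intro analytic_intros) auto
  moreover have "f (of_real t) = of_real (cmod (p (of_real t))) powr \<kappa> *
                        exp (- \<i> * \<kappa> * of_real (\<beta>0 * omega t0 T))"
    if "t \<in> insert t0 (segm_near t0 T R)" for t
  proof -
    have "g (of_real t) = of_real (cmod (p (of_real t)))"
      using that on at0 norm_g by auto
    then show ?thesis by (simp add: f_def \<theta>_def)
  qed
  ultimately show ?thesis
    unfolding power_branch_def by blast
qed

lemma power_branch_germ_unique:
  assumes "power_branch t0 T R \<beta>0 p \<kappa> f" "power_branch t0 T R \<beta>0 p \<kappa> g"
    and "T \<noteq> ereal t0" "R > 0"
  shows "eventually (\<lambda>w. f w = g w) (nhds (of_real t0))"
proof -
  define h where "h w = f w - g w" for w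
  have "h analytic_on {of_real t0}"
    unfolding h_def using assms by (intro analytic_intros) (auto simp: power_branch_def)
  then obtain e where e: "e > 0" "h holomorphic_on ball (of_real t0) e"
    by (auto simp: analytic_on_def)
  define r where "r = min e R"
  have r: "r > 0" "r \<le> R" "r \<le> e" using e assms by (auto simp: r_def)
  have zero: "h w = 0" if "w \<in> of_real ` segm_near t0 T r" for w
    using that assms(1,2) r by (auto simp: h_def power_branch_def segm_near_def)
  have "h w = 0" if "w \<in> ball (of_real t0) e" for w
  proof (rule analytic_continuation[of h "ball (of_real t0) e" "of_real ` segm_near t0 T r" "of_real t0" w])
    show "of_real ` segm_near t0 T r \<subseteq> ball (of_real t0 :: complex) e"
      using r by (auto simp: segm_near_def dist_real_def dist_of_real)
  qed (use e that zero of_real_segm_near_islimpt[OF assms(3) r(1)] in auto)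
  moreover have "eventually (\<lambda>w. w \<in> ball (of_real t0) e) (nhds (of_real t0 :: complex))"
    using e by (intro eventually_nhds_in_open) auto
  ultimately show ?thesis
    by (auto elim!: eventually_mono simp: h_def)
qed

lemma p_power_branch:
  assumes "factorization t0 T a \<phi> R \<alpha>0 \<beta>0 q p" and "T \<noteq> ereal t0"
  shows "power_branch t0 T R \<beta>0 p \<kappa> (p_power t0 T R \<beta>0 p \<kappa>)"
  unfolding p_power_def using power_branch_exists[OF assms] by (rule someI_ex)

end

theory Submission
  imports Defs "HOL-Real_Asymp.Real_Asymp"
begin

text \<open>
  Put \<open>\<psi> = 1 / (- ln (1 - exp (- \<phi>)))\<close>. Then \<open>exp (- \<phi>) = 1 - exp (- 1 / \<psi>)\<close>, so in the variable
  \<open>u = 1 / \<psi>\<close> the weight \<open>exp (- l * \<phi>)\<close> becomes \<open>(1 - exp (- u)) powr l\<close>, the weight in the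
  integral that defines \<open>mellin_beta\<close>. Under the same substitution \<open>\<psi> powr (\<chi> - 1) d\<psi>\<close> becomes
  \<open>u powr (- \<chi> - 1) du\<close>. The expansion is therefore obtained by writing \<open>a dt\<close> near \<open>t0\<close> as a
  combination of the forms \<open>\<psi> powr (\<chi>\<^sub>n - 1) d\<psi>\<close> and integrating term by term.

  Four facts make this work.

  \<^item> The coefficients of that combination are given by the stated derivative formula. This is
    Lagrange inversion, but it needs neither the inverse of \<open>\<psi>\<close> nor contour integration: the
    ansatz is triangular in the order of vanishing, and multiplying it by \<open>p powr (- \<chi>\<^sub>m)\<close>
    isolates the \<open>m\<close>-th coefficient, because the lower terms then become total derivatives
    (\<open>fps_expansion_in_powers\<close>, \<open>analytic_expansion_in_powers\<close>).

  \<^item> \<open>mellin_beta z (l - 1)\<close> is asymptotically \<open>(ln l) powr (- z) / z\<close>: the weight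
    \<open>(1 - exp (- u)) powr l\<close> is a cutoff that jumps from 0 to 1 around \<open>u = ln l\<close>
    (\<open>mellin_beta_asymp\<close>). So consecutive terms of the expansion differ by a
    power of \<open>ln l\<close>, a remainder of the order of the next term is small compared with the last
    term kept, and exponentially small errors do not matter.

  \<^item> The substitution covers only \<open>u > U\<close> for some \<open>U > 0\<close>, but the missing piece of the Mellin
    integral is exponentially small (\<open>mellin_beta_truncation\<close>, \<open>near_integral_asymp\<close>).

  \<^item> Away from \<open>t0\<close> the phase \<open>\<phi>\<close> is bounded below by a positive constant, so that part of
    the integral is exponentially small as well (\<open>phase_bounded_below_off_endpoint\<close>).

  Both directions of the segment are treated at once by the reflection \<open>t = t0 \<plusminus> s\<close>, which turns
  the rotated factor \<open>p * cis (\<beta>0 * \<omega>)\<close> into a function that is positive for small real \<open>s \<ge> 0\<close>; the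
  signs produced by the reflection combine to the factor \<open>exp (\<i> * \<omega>)\<close> (\<open>c_coeff_eq_reflected\<close>).
\<close>

section \<open>Expanding an amplitude in powers of a phase\<close>

text \<open>
  With \<open>P = p powr (- k / \<beta>)\<close> and \<open>D = p' / p\<close>, the product is \<open>\<beta>\<close> times \<open>P - X * P' / k\<close>, and the
  operator \<open>1 - X / k * d/dX\<close> kills the \<open>k\<close>-th coefficient. In terms of residues: up to a constant
  the product divided by \<open>X ^ (k + 1)\<close> is the derivative of \<open>P / X ^ k\<close>.
\<close>

lemma fps_log_derivative_power_coeff:
  fixes P D :: "complex fps"
  assumes "fps_deriv P = fps_const (- of_nat k / \<beta>) * D * P" "k > 0" "\<beta> \<noteq> 0"
  shows "fps_nth (P * (fps_const \<beta> + fps_X * D)) k = 0"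
proof -
  have "fps_X * fps_deriv P = fps_const (- of_nat k / \<beta>) * (P * (fps_X * D))"
    unfolding assms(1) by (simp only: mult_ac)
  then have "fps_nth (fps_X * fps_deriv P) k = - of_nat k / \<beta> * fps_nth (P * (fps_X * D)) k"
    by (simp only: fps_mult_left_const_nth)
  moreover have "fps_nth (fps_X * fps_deriv P) k = of_nat k * fps_nth P k"
    using assms(2) by (cases k) auto
  ultimately have "fps_nth (P * (fps_X * D)) k = - \<beta> * fps_nth P k"
  proof -
    assume *: "fps_nth (fps_X * fps_deriv P) k = - of_nat k / \<beta> * fps_nth (P * (fps_X * D)) k"
      "fps_nth (fps_X * fps_deriv P) k = of_nat k * fps_nth P k"
    have "of_nat k * (\<beta> * fps_nth P k) = \<beta> * (- of_nat k / \<beta> * fps_nth (P * (fps_X * D)) k)"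
      unfolding *(1)[symmetric] *(2) by simp
    also have "\<dots> = of_nat k * (- fps_nth (P * (fps_X * D)) k)"
      using assms(3) by simp
    finally show ?thesis
      using assms(2) by (simp only: mult_cancel_left of_nat_eq_0_iff) simp
  qed
  then show ?thesis
    by (simp add: distrib_left mult.commute[of P "fps_const \<beta>"])
qed

text \<open>
  Here \<open>E \<kappa>\<close> plays the role of \<open>p powr \<kappa>\<close> and \<open>D\<close> that of \<open>p' / p\<close>, so that for
  \<open>\<zeta> n = (\<alpha> + 1 + n) / \<beta>\<close> the \<open>n\<close>-th summand times \<open>X powr \<alpha>\<close> is a multiple of the derivative of
  \<open>(X powr \<beta> * p) powr (\<zeta> n)\<close>. Multiplying the remainder by \<open>E (- \<zeta> m)\<close> leaves in degree \<open>m\<close>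
  only the summand \<open>n = m\<close>: those with \<open>n > m\<close> start too late, those with \<open>n < m\<close> vanish by \<open>fps_log_derivative_power_coeff\<close>. The value
  of \<open>d m\<close> is chosen to cancel what is left, and induction on \<open>m\<close> removes the unit \<open>E (- \<zeta> m)\<close>.
\<close>

lemma fps_expansion_in_powers:
  fixes E :: "complex \<Rightarrow> complex fps" and D Q :: "complex fps" and \<zeta> :: "nat \<Rightarrow> complex"
  assumes \<beta>: "\<beta> \<noteq> 0" and \<zeta>: "\<And>m n. \<zeta> n - \<zeta> m = (of_nat n - of_nat m) / \<beta>"
    and E0: "E 0 = 1" and E_add: "\<And>\<kappa> \<mu>. E (\<kappa> + \<mu>) = E \<kappa> * E \<mu>"
    and E_deriv: "\<And>\<kappa>. fps_deriv (E \<kappa>) = fps_const \<kappa> * D * E \<kappa>"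
    and "m < N"
  defines "d \<equiv> \<lambda>n. fps_nth (Q * E (- \<zeta> n)) n / \<beta>"
  shows "fps_nth (Q - (\<Sum>n<N. fps_const (d n) * (fps_X ^ n * (E (\<zeta> n) * (fps_const \<beta> + fps_X * D))))) m = 0"
    (is "fps_nth ?r m = 0")
  using \<open>m < N\<close>
proof (induction m rule: less_induct)
  case (less m)
  have summand: "fps_nth (fps_const (d n) * (fps_X ^ n * (E (\<zeta> n) * (fps_const \<beta> + fps_X * D))) * E (- \<zeta> m)) m
      = (if n = m then d m * \<beta> else 0)" for n
  proof -
    have "fps_const (d n) * (fps_X ^ n * (E (\<zeta> n) * (fps_const \<beta> + fps_X * D))) * E (- \<zeta> m)
        = fps_const (d n) * (fps_X ^ n * (E (\<zeta> n - \<zeta> m) * (fps_const \<beta> + fps_X * D)))"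
      unfolding diff_conv_add_uminus E_add by (simp add: mult_ac)
    also have "fps_nth \<dots> m = (if n = m then d m * \<beta> else 0)"
    proof (cases n m rule: linorder_cases)
      case less
      have "\<zeta> n - \<zeta> m = - of_nat (m - n) / \<beta>"
        using less by (simp add: \<zeta> of_nat_diff)
      then have "fps_nth (E (\<zeta> n - \<zeta> m) * (fps_const \<beta> + fps_X * D)) (m - n) = 0"
        using less \<beta> E_deriv by (intro fps_log_derivative_power_coeff) auto
      then show ?thesis using less by (simp add: fps_X_power_mult_nth)
    qed (auto simp: fps_X_power_mult_nth E0)
    finally show ?thesis .
  qed
  have "fps_nth (?r * E (- \<zeta> m)) m = fps_nth (Q * E (- \<zeta> m)) m - d m * \<beta>"
    using \<open>m < N\<close>
    by (simp only: left_diff_distrib sum_distrib_right fps_sub_nth fps_sum_nth summand) simp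
  also have "\<dots> = 0"
    using \<beta> by (simp add: d_def)
  finally have "fps_nth (?r * E (- \<zeta> m)) m = 0" .
  \<comment> \<open>all lower coefficients of the remainder vanish, so only one product survives\<close>
  moreover have "fps_nth (?r * E (- \<zeta> m)) m = fps_nth ?r m * fps_nth (E (- \<zeta> m)) 0"
  proof -
    have "fps_nth (?r * E (- \<zeta> m)) m = (\<Sum>i\<in>{m}. fps_nth ?r i * fps_nth (E (- \<zeta> m)) (m - i))"
      unfolding fps_mult_nth
      by (rule sum.mono_neutral_right) (use less in auto)
    then show ?thesis by simp
  qed
  moreover have "fps_nth (E (- \<zeta> m)) 0 \<noteq> 0"
  proof
    assume "fps_nth (E (- \<zeta> m)) 0 = 0"
    moreover have "E (\<zeta> m) * E (- \<zeta> m) = 1"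
      using E_add[of "\<zeta> m" "- \<zeta> m"] E0 by simp
    ultimately show False
      by (metis fps_mult_nth_0 fps_one_nth mult_zero_right zero_neq_one)
  qed
  ultimately show ?case by simp
qed

text \<open>
  A nonvanishing comparison factor \<open>g\<close> is included so that the remainder can be measured
  directly against the first omitted term of the expansion.
\<close>

lemma has_fps_expansion_bound_by_power:
  fixes f g :: "complex \<Rightarrow> complex"
  assumes f: "f has_fps_expansion F" and F: "\<And>m. m < N \<Longrightarrow> fps_nth F m = 0"
    and g: "isCont g 0" "g 0 \<noteq> 0"
  shows "\<exists>C\<ge>0. \<forall>\<^sub>F w in at 0. cmod (f w) \<le> C * cmod (w ^ N * g w)"
proof (cases "F = 0")
  case True
  then have "\<forall>\<^sub>F w in at 0. f w = 0"
    using f by (auto simp: has_fps_expansion_0_iff eventually_at_filter elim: eventually_mono)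
  then show ?thesis
    by (intro exI[of _ 0]) (auto elim: eventually_mono)
next
  case False
  then have "N \<le> subdegree F"
    using F by (metis not_le nth_subdegree_nonzero)
  \<comment> \<open>the removable singularity at 0 is filled in so that the quotient is continuous there\<close>
  then have shift: "(\<lambda>w. if w = 0 then fps_nth F N else f w / w ^ N) has_fps_expansion fps_shift N F"
    by (intro has_fps_expansion_shift f refl)
  have "isCont (\<lambda>w. (if w = 0 then fps_nth F N else f w / w ^ N) / g w) 0"
    using has_fps_expansion_imp_continuous[OF shift, of UNIV] g
    by (intro continuous_divide) auto
  then have lim: "((\<lambda>w. cmod ((if w = 0 then fps_nth F N else f w / w ^ N) / g w))
      \<longlongrightarrow> cmod (fps_nth F N / g 0)) (at 0)"
    unfolding isCont_def by (intro tendsto_norm) simp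
  define C where "C = cmod (fps_nth F N / g 0) + 1"
  have C: "\<forall>\<^sub>F w in at 0. cmod ((if w = 0 then fps_nth F N else f w / w ^ N) / g w) < C"
    by (rule order_tendstoD[OF lim]) (simp add: C_def)
  have ne: "\<forall>\<^sub>F w in at 0. g w \<noteq> 0"
    using g unfolding isCont_def by (rule tendsto_imp_eventually_ne)
  have "\<forall>\<^sub>F w in at 0. w \<noteq> (0::complex)"
    by (simp add: eventually_at_filter)
  with C ne have "\<forall>\<^sub>F w in at 0. cmod (f w) \<le> C * cmod (w ^ N * g w)"
  proof eventually_elim
    case (elim w)
    then show ?case by (simp add: norm_divide norm_mult norm_power divide_simps mult_ac)
  qed
  then show ?thesis by (intro exI[of _ C]) (auto simp: C_def)
qed

text \<open>
  The formal expansion applied to \<open>p = exp h\<close>; working with the logarithm \<open>h\<close> makes all powers of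
  \<open>p\<close> available without a choice of branch.
\<close>

lemma analytic_expansion_in_powers:
  fixes h q :: "complex \<Rightarrow> complex" and \<beta> :: complex and \<zeta> :: "nat \<Rightarrow> complex"
  assumes h: "h analytic_on {0}" and q: "q analytic_on {0}" and \<beta>: "\<beta> \<noteq> 0"
    and \<zeta>: "\<And>m n. \<zeta> n - \<zeta> m = (of_nat n - of_nat m) / \<beta>"
  defines "d \<equiv> \<lambda>n. (deriv ^^ n) (\<lambda>w. q w * exp (- \<zeta> n * h w)) 0 / fact n / \<beta>"
  shows "\<exists>C\<ge>0. \<forall>\<^sub>F w in at 0.
    cmod (q w - (\<Sum>n<N. d n * (w ^ n * (exp (\<zeta> n * h w) * (\<beta> + w * deriv h w)))))
      \<le> C * cmod (w ^ N * (exp (\<zeta> N * h w) * (\<beta> + w * deriv h w)))"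
proof -
  define E where "E \<kappa> = fps_expansion (\<lambda>w. exp (\<kappa> * h w)) 0" for \<kappa>
  define H where "H = fps_expansion h 0"
  define Q where "Q = fps_expansion q 0"
  have E: "(\<lambda>w. exp (\<kappa> * h w)) has_fps_expansion E \<kappa>" for \<kappa>
    unfolding E_def using h by (intro analytic_at_imp_has_fps_expansion_0 analytic_intros)
  have H: "h has_fps_expansion H" and Q: "q has_fps_expansion Q"
    unfolding H_def Q_def using h q by (auto intro: analytic_at_imp_has_fps_expansion_0)
  have E0: "E 0 = 1"
    by (rule fps_expansion_unique_complex[OF E]) simp
  have E_add: "E (\<kappa> + \<mu>) = E \<kappa> * E \<mu>" for \<kappa> \<mu>
    by (rule fps_expansion_unique_complex[OF E])
       (simp add: distrib_right exp_add has_fps_expansion_mult[OF E E])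
  have E_deriv: "fps_deriv (E \<kappa>) = fps_const \<kappa> * fps_deriv H * E \<kappa>" for \<kappa>
  proof (rule fps_expansion_unique_complex[OF has_fps_expansion_deriv[OF E]])
    obtain S where "open S" "0 \<in> S" "h holomorphic_on S"
      using h by (auto simp: analytic_at)
    then have "\<forall>\<^sub>F w in nhds 0. h analytic_on {w}"
      by (auto simp: eventually_nhds analytic_at)
    then have ev: "\<forall>\<^sub>F w in nhds 0. deriv (\<lambda>w. exp (\<kappa> * h w)) w = \<kappa> * deriv h w * exp (\<kappa> * h w)"
    proof eventually_elim
      case (elim w)
      then have "(h has_field_derivative deriv h w) (at w)"
        by (simp add: analytic_on_imp_differentiable_at DERIV_deriv_iff_field_differentiable)
      then show ?case
        by (intro DERIV_imp_deriv) (auto intro!: derivative_eq_intros)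
    qed
    have "(\<lambda>w. \<kappa> * deriv h w * exp (\<kappa> * h w)) has_fps_expansion fps_const \<kappa> * fps_deriv H * E \<kappa>"
      by (intro fps_expansion_intros H E)
    then show "deriv (\<lambda>w. exp (\<kappa> * h w)) has_fps_expansion fps_const \<kappa> * fps_deriv H * E \<kappa>"
      using has_fps_expansion_cong[OF ev refl] by simp
  qed
  have d: "d n = fps_nth (Q * E (- \<zeta> n)) n / \<beta>" for n
    unfolding d_def using fps_nth_fps_expansion[OF has_fps_expansion_mult[OF Q E]] by simp
  define R where "R = Q - (\<Sum>n<N. fps_const (d n) * (fps_X ^ n * (E (\<zeta> n) * (fps_const \<beta> + fps_X * fps_deriv H))))"
  define r where "r w = q w - (\<Sum>n<N. d n * (w ^ n * (exp (\<zeta> n * h w) * (\<beta> + w * deriv h w))))" for w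
  define g where "g w = exp (\<zeta> N * h w) * (\<beta> + w * deriv h w)" for w
  have r: "r has_fps_expansion R"
    unfolding r_def R_def by (intro fps_expansion_intros Q E H)
  have "fps_nth R m = 0" if "m < N" for m
    unfolding R_def d using \<beta> \<zeta> E0 E_add E_deriv that by (rule fps_expansion_in_powers)
  moreover have "g has_fps_expansion E (\<zeta> N) * (fps_const \<beta> + fps_X * fps_deriv H)"
    unfolding g_def by (intro fps_expansion_intros E H)
  then have "isCont g 0"
    by (rule has_fps_expansion_imp_continuous)
  moreover have "g 0 \<noteq> 0" using \<beta> by (simp add: g_def)
  ultimately show ?thesis
    using has_fps_expansion_bound_by_power[OF r] unfolding r_def g_def by blast
qed

section \<open>Size of the Mellin transform of the beta function\<close>

text \<open>
  One dominating function for two purposes: integrability of the Mellin integrand and dominated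
  convergence as \<open>l\<close> tends to infinity.
\<close>

lemma set_integrable_powr_01_and_inf:
  fixes \<kappa> \<sigma> :: real
  assumes "\<kappa> > 0" "\<sigma> > 0"
  shows "set_integrable lborel {0<..} (\<lambda>t. if t \<le> 1 then t powr (\<kappa> - 1) else t powr (- \<sigma> - 1))"
proof -
  let ?f = "\<lambda>t::real. if t \<le> 1 then t powr (\<kappa> - 1) else t powr (- \<sigma> - 1)"
  have "(\<lambda>x::real. x powr (\<kappa> - 1)) absolutely_integrable_on {0..1}"
    using assms by (intro nonnegative_absolutely_integrable_1 integrable_on_powr_from_0) auto
  then have "set_integrable lborel {0..1} (\<lambda>x::real. x powr (\<kappa> - 1))"
    unfolding set_integrable_def by (subst (asm) integrable_completion) auto
  then have 1: "set_integrable lborel {0<..1} (\<lambda>x::real. x powr (\<kappa> - 1))"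
    by (rule set_integrable_subset) auto
  have "(\<lambda>x::real. x powr (- \<sigma> - 1)) absolutely_integrable_on {1..}"
    using has_integral_powr_to_inf[of "- \<sigma> - 1" 1] assms
    by (intro nonnegative_absolutely_integrable_1) auto
  then have "set_integrable lborel {1..} (\<lambda>x::real. x powr (- \<sigma> - 1))"
    unfolding set_integrable_def by (subst (asm) integrable_completion) auto
  then have 2: "set_integrable lborel {1<..} (\<lambda>x::real. x powr (- \<sigma> - 1))"
    by (rule set_integrable_subset) auto
  have "set_integrable lborel ({0<..1} \<union> {1<..}) ?f"
  proof (rule set_integrable_Un)
    show "set_integrable lborel {0<..1} ?f"
      using 1 by (rule set_integrable_cong[THEN iffD1, rotated 3]) auto
    show "set_integrable lborel {1<..} ?f"
      using 2 by (rule set_integrable_cong[THEN iffD1, rotated 3]) auto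
  qed auto
  moreover have "{0<..1} \<union> {1<..} = {0::real<..}" by auto
  ultimately show ?thesis by simp
qed

lemma mellin_beta_set_integrable:
  assumes "0 < Re z" "Re z < l"
  shows "set_integrable lborel {0<..}
    (\<lambda>t. of_real t powr (- z - 1) * of_real ((1 - exp (- t)) powr l) :: complex)"
proof (rule set_integrable_bound)
  show "set_integrable lborel {0<..} (\<lambda>t. if t \<le> 1 then t powr (l - Re z - 1) else t powr (- Re z - 1))"
    using assms by (intro set_integrable_powr_01_and_inf) auto
  show "set_borel_measurable lborel {0<..} (\<lambda>t. of_real t powr (- z - 1) * of_real ((1 - exp (- t)) powr l) :: complex)"
    unfolding set_borel_measurable_def by measurable
  have "norm (of_real t powr (- z - 1) * of_real ((1 - exp (- t)) powr l) :: complex)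
    \<le> norm (if t \<le> 1 then t powr (l - Re z - 1) else t powr (- Re z - 1))" if "t \<in> {0<..}" for t
  proof -
    have "(1 - exp (- t)) powr l \<le> (if t \<le> 1 then t powr l else 1)"
      using that assms exp_ge_add_one_self[of "- t"] by (auto intro!: powr_mono2 powr_le1)
    then have "t powr (- Re z - 1) * (1 - exp (- t)) powr l
        \<le> t powr (- Re z - 1) * (if t \<le> 1 then t powr l else 1)"
      by (intro mult_left_mono) auto
    also have "\<dots> = (if t \<le> 1 then t powr (l - Re z - 1) else t powr (- Re z - 1))"
      by (simp add: algebra_simps flip: powr_add)
    finally show ?thesis using that
      by (simp add: norm_mult norm_powr_real_powr)
  qed
  then show "AE t in lborel. t \<in> {0<..} \<longrightarrow> norm (of_real t powr (- z - 1) * of_real ((1 - exp (- t)) powr l) :: complex)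
    \<le> norm (if t \<le> 1 then t powr (l - Re z - 1) else t powr (- Re z - 1))"
    by auto
qed

lemma tendsto_double_exp_cutoff:
  fixes v :: real
  assumes "v > 0" "v \<noteq> 1"
  shows "((\<lambda>l. (1 - exp (- (v * ln l))) powr l) \<longlongrightarrow> (if v > 1 then 1 else 0)) at_top"
proof (cases "v > 1")
  case True
  then have "((\<lambda>l. (1 - exp (- (v * ln l))) powr l) \<longlongrightarrow> 1) at_top"
    by real_asymp
  then show ?thesis using True by simp
next
  case False
  then have "v < 1" using assms by simp
  then have "((\<lambda>l. (1 - exp (- (v * ln l))) powr l) \<longlongrightarrow> 0) at_top"
    using assms by real_asymp
  then show ?thesis using False by simp
qed

text \<open>
  Pointwise convergence of the cutoff is not enough near \<open>v = 0\<close>, where \<open>v powr (- z - 1)\<close> is not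
  integrable. For \<open>v \<le> 1/2\<close> a factor \<open>(1 - exp (- (v * ln l))) powr k \<le> (v * ln l) powr k\<close> is split
  off; the power of \<open>ln l\<close> is absorbed by what remains, since
  \<open>(1 - l powr (- 1/2)) powr (l - k)\<close> decays like \<open>exp (- sqrt l)\<close>. For \<open>v > 1/2\<close> the trivial bound 1
  suffices.
\<close>

lemma double_exp_cutoff_bound:
  fixes k :: real
  assumes k: "k > 0"
  shows "\<forall>\<^sub>F l in at_top. \<forall>v>0. (1 - exp (- (v * ln l))) powr l
    \<le> (if v \<le> 1 then 2 powr k * v powr k else 1)"
proof -
  have "((\<lambda>l::real. ln l powr k * exp (- ((l - k) * exp (- (ln l / 2))))) \<longlongrightarrow> 0) at_top"
    using k by real_asymp
  then have 1: "\<forall>\<^sub>F l::real in at_top. ln l powr k * exp (- ((l - k) * exp (- (ln l / 2)))) < 1"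
    by (rule order_tendstoD) simp
  show ?thesis
    using 1 eventually_gt_at_top[of 1] eventually_gt_at_top[of k]
  proof eventually_elim
    case (elim l)
    show ?case
    proof (intro allI impI)
      fix v :: real assume v: "v > 0"
      define y where "y = 1 - exp (- (v * ln l))"
      have L: "ln l > 0" using elim by simp
      have y: "0 < y" "y < 1" "y \<le> v * ln l"
        using v L exp_ge_add_one_self[of "- (v * ln l)"] by (auto simp: y_def)
      have le1: "y powr l \<le> 1" using y elim k by (intro powr_le1) auto
      consider "v > 1" | "1/2 < v" "v \<le> 1" | "v \<le> 1/2" by linarith
      then have "y powr l \<le> (if v \<le> 1 then 2 powr k * v powr k else 1)"
      proof cases
        case 2
        have "1 \<le> (2 * v) powr k" using 2 k by (intro ge_one_powr_ge_zero) auto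
        then show ?thesis using le1 2 v by (simp add: powr_mult)
      next
        case 3
        have "ln y \<le> - exp (- (v * ln l))"
          using ln_add_one_self_le_self2[of "- exp (- (v * ln l))"] v L by (simp add: y_def)
        also have "\<dots> \<le> - exp (- (ln l / 2))" using 3 L by simp
        finally have "(l - k) * ln y \<le> - ((l - k) * exp (- (ln l / 2)))"
          using elim mult_left_mono[of "ln y" "- exp (- (ln l / 2))" "l - k"] by simp
        then have a: "y powr (l - k) \<le> exp (- ((l - k) * exp (- (ln l / 2))))"
          using y by (simp add: powr_def)
        have "y powr l = y powr k * y powr (l - k)"
          by (simp flip: powr_add)
        also have "\<dots> \<le> (v * ln l) powr k * exp (- ((l - k) * exp (- (ln l / 2))))"
          using a y k by (intro mult_mono powr_mono2) auto
        also have "\<dots> = v powr k * (ln l powr k * exp (- ((l - k) * exp (- (ln l / 2)))))"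
          using v L by (simp add: powr_mult)
        also have "\<dots> \<le> v powr k * 1"
          using elim by (intro mult_left_mono) auto
        also have "\<dots> \<le> 2 powr k * v powr k"
          using k ge_one_powr_ge_zero[of 2 k] mult_right_mono[of 1 "2 powr k" "v powr k"] by simp
        finally show ?thesis using 3 by simp
      qed (use le1 in auto)
      then show "(1 - exp (- (v * ln l))) powr l \<le> (if v \<le> 1 then 2 powr k * v powr k else 1)"
        by (simp add: y_def)
    qed
  qed
qed

lemma powr_one_to_inf_integral:
  assumes "Re z > 0"
  shows "(LINT v:{1<..}|lborel. of_real v powr (- z - 1) :: complex) = 1 / z"
    and "set_integrable lborel {1<..} (\<lambda>v. of_real v powr (- z - 1) :: complex)"
proof -
  have z: "z \<noteq> 0" using assms by auto
  show int: "set_integrable lborel {1<..} (\<lambda>v. of_real v powr (- z - 1) :: complex)"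
  proof (rule set_integrable_bound)
    show "set_integrable lborel {1<..} (\<lambda>t. if t \<le> 1 then t powr (1 - 1) else t powr (- Re z - 1))"
      by (rule set_integrable_subset[OF set_integrable_powr_01_and_inf]) (use assms in auto)
    show "set_borel_measurable lborel {1<..} (\<lambda>v. of_real v powr (- z - 1) :: complex)"
      unfolding set_borel_measurable_def by measurable
  qed (auto simp: norm_powr_real_powr)
  have lim: "((\<lambda>x. - (of_real x powr (- z)) / z) \<longlongrightarrow> 0) at_top"
  proof (rule tendsto_norm_zero_cancel)
    have "((\<lambda>x. x powr (- Re z) / cmod z) \<longlongrightarrow> 0 / cmod z) at_top"
      using assms z by (intro tendsto_divide tendsto_neg_powr filterlim_ident tendsto_const) auto
    moreover have "\<forall>\<^sub>F x in at_top. x powr (- Re z) / cmod z = norm (- (of_real x powr (- z)) / z)"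
      using eventually_gt_at_top[of 0] by eventually_elim (simp add: norm_divide norm_powr_real_powr)
    ultimately show "((\<lambda>x. norm (- (of_real x powr (- z)) / z)) \<longlongrightarrow> 0) at_top"
      by (simp add: filterlim_cong)
  qed
  have "(LBINT x=1..\<infinity>. of_real x powr (- z - 1) :: complex) = 0 - (- (of_real 1 powr (- z)) / z)"
  proof (rule interval_integral_FTC_integrable)
    show "((\<lambda>x. - (of_real x powr (- z)) / z) has_vector_derivative of_real x powr (- z - 1)) (at x)"
      if "1 < ereal x" "ereal x < \<infinity>" for x
    proof -
      have "x > 1" using that by simp
      then have "((\<lambda>w. - (w powr (- z)) / z) has_field_derivative of_real x powr (- z - 1)) (at (of_real x))"
        using z by (auto intro!: derivative_eq_intros simp: powr_diff)
      then show ?thesis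
        using has_vector_derivative_real_field by blast
    qed
    show "isCont (\<lambda>x. of_real x powr (- z - 1) :: complex) x" if "1 < ereal x" "ereal x < \<infinity>" for x
      using that by (intro continuous_intros) auto
    show "set_integrable lborel (einterval 1 \<infinity>) (\<lambda>v. of_real v powr (- z - 1) :: complex)"
      using int by (simp add: einterval_def greaterThan_def one_ereal_def)
    have "isCont (\<lambda>x. - (of_real x powr (- z)) / z :: complex) 1"
      using z by (intro continuous_intros) auto
    then show "(((\<lambda>x. - (of_real x powr (- z)) / z) \<circ> real_of_ereal) \<longlongrightarrow> - (of_real 1 powr (- z)) / z) (at_right 1)"
      unfolding one_ereal_def ereal_tendsto_simps isCont_def by (rule tendsto_within_subset) auto
    show "(((\<lambda>x. - (of_real x powr (- z)) / z) \<circ> real_of_ereal) \<longlongrightarrow> 0) (at_left \<infinity>)"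
      unfolding ereal_tendsto_simps by (rule lim)
  qed auto
  then show "(LINT v:{1<..}|lborel. of_real v powr (- z - 1) :: complex) = 1 / z"
    by (simp add: interval_lebesgue_integral_def einterval_def greaterThan_def one_ereal_def)
qed

text \<open>
  The substitution \<open>t = v * ln l\<close> fixes the position of the cutoff at \<open>v = 1\<close>.
\<close>

lemma mellin_beta_scaled:
  assumes "l > 1"
  shows "mellin_beta z (l - 1) * of_real (ln l) powr z =
    (LINT v:{0<..}|lborel. of_real v powr (- z - 1) * of_real ((1 - exp (- (v * ln l))) powr l))"
proof -
  have L: "ln l > 0" using assms by simp
  let ?f = "\<lambda>t. indicat_real {0<..} t *\<^sub>R (of_real t powr (- z - 1) * of_real ((1 - exp (- t)) powr l) :: complex)"
  have "mellin_beta z (l - 1) = (LINT t|lborel. ?f t)"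
    by (simp add: mellin_beta_def set_lebesgue_integral_def)
  also have "\<dots> = ln l *\<^sub>R (LINT v|lborel. ?f (0 + ln l * v))"
    using L by (subst lborel_integral_real_affine[of "ln l" _ 0]) auto
  also have "\<dots> = (LINT v|lborel. ln l *\<^sub>R ?f (ln l * v))"
    by (simp only: add_0 integral_scaleR_right)
  finally have "mellin_beta z (l - 1) * of_real (ln l) powr z
      = (LINT v|lborel. ln l *\<^sub>R ?f (ln l * v) * of_real (ln l) powr z)"
    using L by (simp only: integral_mult_left_zero)
  also have "\<dots> = (LINT v|lborel. indicat_real {0<..} v *\<^sub>R
      (of_real v powr (- z - 1) * of_real ((1 - exp (- (v * ln l))) powr l)))"
  proof (rule Bochner_Integration.integral_cong[OF refl])
    fix v :: real
    show "ln l *\<^sub>R ?f (ln l * v) * of_real (ln l) powr z = indicat_real {0<..} v *\<^sub>R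
      (of_real v powr (- z - 1) * of_real ((1 - exp (- (v * ln l))) powr l))"
    proof (cases "v > 0")
      case True
      have "of_real (ln l) * (of_real (ln l * v) powr (- z - 1)) * of_real (ln l) powr z
          = (of_real v powr (- z - 1) :: complex)"
        using L True by (simp add: powr_times_real powr_diff powr_minus field_simps)
      then show ?thesis
        using L True by (simp add: scaleR_conv_of_real indicator_def mult_ac)
    next
      case False
      then show ?thesis using L by (simp add: indicator_def zero_less_mult_iff)
    qed
  qed
  finally show ?thesis
    by (simp add: set_lebesgue_integral_def)
qed

text \<open>
  After scaling, the integrand tends to \<open>v powr (- z - 1)\<close> on \<open>v > 1\<close> and to 0 on \<open>v < 1\<close>, and the
  limit integral is \<open>1 / z\<close>.
\<close>

lemma mellin_beta_asymp:
  assumes z: "Re z > 0"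
  shows "((\<lambda>l. mellin_beta z (l - 1) * of_real (ln l) powr z) \<longlongrightarrow> 1 / z) at_top"
proof -
  \<comment> \<open>this power of \<open>v\<close> exactly compensates \<open>v powr (- Re z - 1)\<close> on \<open>v \<le> 1\<close>\<close>
  define k where "k = Re z + 1"
  let ?F = "\<lambda>l v. indicat_real {0<..} v *\<^sub>R (of_real v powr (- z - 1) * of_real ((1 - exp (- (v * ln l))) powr l) :: complex)"
  let ?w = "\<lambda>v. indicat_real {0<..} v *\<^sub>R (2 powr k * (if v \<le> 1 then v powr (1 - 1) else v powr (- Re z - 1)))"
  have "((\<lambda>l. LINT v|lborel. ?F l v) \<longlongrightarrow>
      (LINT v|lborel. indicat_real {1<..} v *\<^sub>R (of_real v powr (- z - 1)))) at_top"
  proof (rule integral_dominated_convergence_at_top)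
    show "integrable lborel ?w"
      using set_integrable_mult_right[of "2 powr k", OF set_integrable_powr_01_and_inf[of 1 "Re z"]] z
      by (simp add: set_integrable_def)
    have "AE v in lborel. v \<noteq> (1::real)"
      by (rule AE_lborel_singleton)
    then show "AE v in lborel. ((\<lambda>l. ?F l v) \<longlongrightarrow> indicat_real {1<..} v *\<^sub>R (of_real v powr (- z - 1))) at_top"
    proof eventually_elim
      case (elim v)
      show ?case
      proof (cases "v > 0")
        case True
        have "((\<lambda>l. of_real v powr (- z - 1) * of_real ((1 - exp (- (v * ln l))) powr l) :: complex)
            \<longlongrightarrow> of_real v powr (- z - 1) * of_real (if v > 1 then 1 else 0)) at_top"
          by (intro tendsto_intros tendsto_double_exp_cutoff True elim)
        moreover have "indicat_real {1<..} v *\<^sub>R (of_real v powr (- z - 1) :: complex)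
            = of_real v powr (- z - 1) * of_real (if v > 1 then 1 else 0)"
          by (auto simp: indicator_def)
        ultimately show ?thesis using True by (simp only: indicator_simps greaterThan_iff scaleR_one)
      qed auto
    qed
    have k: "k > 0" using z by (simp add: k_def)
    show "\<forall>\<^sub>F l in at_top. AE v in lborel. norm (?F l v) \<le> ?w v"
      using double_exp_cutoff_bound[OF k]
    proof eventually_elim
      case (elim l)
      have "norm (?F l v) \<le> ?w v" if "v > 0" for v
      proof -
        have "v powr (- Re z - 1) * (1 - exp (- (v * ln l))) powr l
            \<le> v powr (- Re z - 1) * (if v \<le> 1 then 2 powr k * v powr k else 1)"
          using elim that by (intro mult_left_mono) auto
        also have "\<dots> \<le> 2 powr k * (if v \<le> 1 then v powr (1 - 1) else v powr (- Re z - 1))"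
        proof (cases "v \<le> 1")
          case True
          have "v powr (- Re z - 1) * v powr k = v powr (1 - 1)"
            by (simp add: k_def flip: powr_add)
          then show ?thesis using True by (simp add: mult_ac)
        next
          case False
          then show ?thesis
            using k ge_one_powr_ge_zero[of 2 k] mult_right_mono[of 1 "2 powr k" "v powr (- Re z - 1)"] by simp
        qed
        finally show ?thesis
          using that by (simp add: norm_mult norm_powr_real_powr)
      qed
      then have "norm (?F l v) \<le> ?w v" for v
        by (cases "v > 0") simp_all
      then show ?case by simp
    qed
  qed measurable
  then have "((\<lambda>l. LINT v|lborel. ?F l v) \<longlongrightarrow> 1 / z) at_top"
    using powr_one_to_inf_integral(1)[OF z] by (simp add: set_lebesgue_integral_def)
  moreover have "\<forall>\<^sub>F l in at_top. (LINT v|lborel. ?F l v) = mellin_beta z (l - 1) * of_real (ln l) powr z"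
    using eventually_gt_at_top[of 1]
    by eventually_elim (simp add: mellin_beta_scaled set_lebesgue_integral_def)
  ultimately show ?thesis
    by (simp add: filterlim_cong)
qed

lemma mellin_beta_bigtheta:
  assumes z: "Re z > 0"
  shows "(\<lambda>l. mellin_beta z (l - 1)) \<in> \<Theta>[at_top](\<lambda>l. of_real (ln l powr (- Re z)))"
proof -
  have "((\<lambda>l. norm (mellin_beta z (l - 1) * of_real (ln l) powr z)) \<longlongrightarrow> norm (1 / z)) at_top"
    by (intro tendsto_norm mellin_beta_asymp z)
  moreover have "\<forall>\<^sub>F l in at_top. norm (mellin_beta z (l - 1) * of_real (ln l) powr z)
      = norm (mellin_beta z (l - 1) / of_real (ln l powr (- Re z)))"
    using eventually_gt_at_top[of 1]
    by eventually_elim (simp add: norm_mult norm_divide norm_powr_real_powr powr_minus divide_inverse)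
  ultimately have "((\<lambda>l. norm (mellin_beta z (l - 1) / of_real (ln l powr (- Re z)))) \<longlongrightarrow> norm (1 / z)) at_top"
    by (simp add: filterlim_cong)
  then show ?thesis
    using z by (intro bigthetaI_tendsto_norm[of "norm (1 / z)"]) auto
qed

section \<open>The substitution that flattens the phase\<close>

lemma exp_decay_bigo_ln_powr:
  fixes c \<tau> :: real
  assumes "c > 0"
  shows "(\<lambda>l. of_real (exp (- c * l)) :: complex) \<in> O[at_top](\<lambda>l. of_real (ln l powr (- \<tau>)))"
proof -
  have "(\<lambda>l. exp (- c * l)) \<in> O[at_top](\<lambda>l. ln l powr (- \<tau>))"
    using assms by real_asymp
  then show ?thesis
    by (simp add: landau_o.big.of_real_iff)
qed

text \<open>
  The factor \<open>exp (- (l - l0) * f)\<close> is at most \<open>exp (- m * (l - l0))\<close>. This serves both for the part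
  of the segment away from the endpoint and for the truncation of the Mellin integral.
\<close>

lemma laplace_integral_bigo_exp:
  fixes f :: "real \<Rightarrow> real" and A :: "real \<Rightarrow> complex"
  assumes int: "set_integrable lborel S (\<lambda>t. exp (- l0 * f t) * cmod (A t))"
    and f: "\<And>t. t \<in> S \<Longrightarrow> m \<le> f t"
  shows "(\<lambda>l. LINT t:S|lborel. of_real (exp (- l * f t)) * A t) \<in> O[at_top](\<lambda>l. of_real (exp (- m * l)))"
proof (rule bigoI)
  let ?I = "LINT t:S|lborel. exp (- l0 * f t) * cmod (A t)"
  show "\<forall>\<^sub>F l in at_top. cmod (LINT t:S|lborel. of_real (exp (- l * f t)) * A t)
      \<le> (exp (l0 * m) * ?I) * cmod (of_real (exp (- m * l)))"
    using eventually_ge_at_top[of l0]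
  proof eventually_elim
    case (elim l)
    have "cmod (LINT t:S|lborel. of_real (exp (- l * f t)) * A t)
        \<le> (LINT t|lborel. cmod (indicat_real S t *\<^sub>R (of_real (exp (- l * f t)) * A t)))"
      unfolding set_lebesgue_integral_def by (rule integral_norm_bound)
    also have "\<dots> \<le> (LINT t|lborel. exp (- m * (l - l0)) * (indicat_real S t *\<^sub>R (exp (- l0 * f t) * cmod (A t))))"
    proof (rule integral_mono')
      show "integrable lborel (\<lambda>t. exp (- m * (l - l0)) * (indicat_real S t *\<^sub>R (exp (- l0 * f t) * cmod (A t))))"
        using int unfolding set_integrable_def by (rule integrable_mult_right)
      fix t
      show "cmod (indicat_real S t *\<^sub>R (of_real (exp (- l * f t)) * A t))
          \<le> exp (- m * (l - l0)) * (indicat_real S t *\<^sub>R (exp (- l0 * f t) * cmod (A t)))"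
      proof (cases "t \<in> S")
        case True
        have "exp (- l * f t) = exp (- f t * (l - l0)) * exp (- l0 * f t)"
          by (simp add: algebra_simps flip: exp_add)
        also have "\<dots> \<le> exp (- m * (l - l0)) * exp (- l0 * f t)"
          using f[OF True] elim by (intro mult_right_mono) (auto intro: mult_right_mono)
        finally have "exp (- l * f t) * cmod (A t) \<le> exp (- m * (l - l0)) * exp (- l0 * f t) * cmod (A t)"
          by (rule mult_right_mono) simp
        then show ?thesis
          using True by (simp add: norm_mult mult_ac)
      qed auto
    qed auto
    also have "\<dots> = exp (- m * (l - l0)) * ?I"
      unfolding set_lebesgue_integral_def by (rule integral_mult_right_zero)
    also have "exp (- m * (l - l0)) = exp (l0 * m) * exp (- m * l)"
      by (simp add: algebra_simps flip: exp_add)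
    finally show ?case by (simp add: mult_ac)
  qed
qed

text \<open>
  The weight is a Laplace factor \<open>exp (- l * f)\<close> with \<open>f t = - ln (1 - exp (- t))\<close>, and \<open>f\<close> is
  decreasing, hence bounded below by \<open>f U > 0\<close> on the truncated piece.
\<close>

lemma mellin_beta_truncation:
  assumes z: "Re z > 0" and U: "U > 0"
  shows "(\<lambda>l. mellin_beta z (l - 1) -
      (LINT t:{U<..}|lborel. of_real t powr (- z - 1) * of_real ((1 - exp (- t)) powr l)))
    \<in> O[at_top](\<lambda>l. of_real (ln l powr (- \<tau>)))"
proof -
  define f where "f t = - ln (1 - exp (- t))" for t :: real
  have K: "(1 - exp (- t)) powr l = exp (- l * f t)" if "t > 0" for t l
    using that by (simp add: f_def powr_def mult_ac)
  have int: "set_integrable lborel S (\<lambda>t. of_real t powr (- z - 1) * of_real ((1 - exp (- t)) powr l) :: complex)"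
    if "S \<subseteq> {0<..}" "S \<in> sets lborel" "l > Re z" for S l
    using that z by (intro set_integrable_subset[OF mellin_beta_set_integrable]) auto
  have "(\<lambda>l. LINT t:{0<..U}|lborel. of_real (exp (- l * f t)) * of_real t powr (- z - 1))
      \<in> O[at_top](\<lambda>l. of_real (exp (- f U * l)))"
  proof (rule laplace_integral_bigo_exp)
    have "set_integrable lborel {0<..U} (\<lambda>t. cmod (of_real t powr (- z - 1) * of_real ((1 - exp (- t)) powr (Re z + 1))))"
      by (intro set_integrable_norm int) auto
    then show "set_integrable lborel {0<..U} (\<lambda>t. exp (- (Re z + 1) * f t) * cmod (of_real t powr (- z - 1)))"
      by (rule set_integrable_cong[THEN iffD1, rotated 3]) (auto simp: K norm_mult)
    show "f U \<le> f t" if "t \<in> {0<..U}" for t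
      using that U by (auto simp: f_def)
  qed
  moreover have "f U > 0" using U by (simp add: f_def)
  ultimately have "(\<lambda>l. LINT t:{0<..U}|lborel. of_real (exp (- l * f t)) * of_real t powr (- z - 1))
      \<in> O[at_top](\<lambda>l. of_real (ln l powr (- \<tau>)))"
    using exp_decay_bigo_ln_powr landau_o.big_trans by blast
  moreover have "\<forall>\<^sub>F l in at_top. (LINT t:{0<..U}|lborel. of_real (exp (- l * f t)) * of_real t powr (- z - 1)) =
      mellin_beta z (l - 1) - (LINT t:{U<..}|lborel. of_real t powr (- z - 1) * of_real ((1 - exp (- t)) powr l))"
    using eventually_gt_at_top[of "Re z"]
  proof eventually_elim
    case (elim l)
    let ?g = "\<lambda>t. of_real t powr (- z - 1) * of_real ((1 - exp (- t)) powr l) :: complex"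
    have "mellin_beta z (l - 1) = (LINT t:{0<..U} \<union> {U<..}|lborel. ?g t)"
      using U by (simp add: mellin_beta_def ivl_disj_un)
    also have "\<dots> = (LINT t:{0<..U}|lborel. ?g t) + (LINT t:{U<..}|lborel. ?g t)"
      using elim U by (intro set_integral_Un int) auto
    also have "(LINT t:{0<..U}|lborel. ?g t) = (LINT t:{0<..U}|lborel. of_real (exp (- l * f t)) * of_real t powr (- z - 1))"
      by (rule set_lebesgue_integral_cong) (auto simp: K)
    finally show ?case by simp
  qed
  ultimately show ?thesis
    by (simp cong: landau_o.big.in_cong)
qed

lemma set_integral_substitution_open:
  fixes g g' :: "real \<Rightarrow> real" and F :: "real \<Rightarrow> 'a :: euclidean_space"
  assumes S: "open S" and T: "open T"
    and der: "\<And>s. s \<in> S \<Longrightarrow> (g has_real_derivative g' s) (at s)"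
    and inj: "inj_on g S" and img: "g ` S = T"
    and cont: "continuous_on S g'" "continuous_on T F"
    and int: "set_integrable lborel T F"
  shows "set_integrable lborel S (\<lambda>s. \<bar>g' s\<bar> *\<^sub>R F (g s))"
    and "(LINT s:S|lborel. \<bar>g' s\<bar> *\<^sub>R F (g s)) = (LINT u:T|lborel. F u)"
proof -
  have S': "S \<in> sets lebesgue"
    using S by auto
  have der': "(g has_field_derivative g' s) (at s within S)" if "s \<in> S" for s
    using der[OF that] by (rule has_field_derivative_at_within)
  have "set_integrable lebesgue T F"
    using int unfolding set_integrable_def by (subst integrable_completion) auto
  with has_absolute_integral_change_of_variables_real[OF S' der' inj, where f = F and b = "integral T F"] img
  have *: "(\<lambda>s. \<bar>g' s\<bar> *\<^sub>R F (g s)) absolutely_integrable_on S"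
    "integral S (\<lambda>s. \<bar>g' s\<bar> *\<^sub>R F (g s)) = integral T F"
    by auto
  have "continuous_on S g"
    using der by (meson DERIV_isCont continuous_at_imp_continuous_on)
  then have "continuous_on S (\<lambda>s. \<bar>g' s\<bar> *\<^sub>R F (g s))"
    using cont img by (intro continuous_intros continuous_on_compose2[OF cont(2)]) auto
  then have "(\<lambda>s. indicat_real S s *\<^sub>R (\<bar>g' s\<bar> *\<^sub>R F (g s))) \<in> borel_measurable borel"
    using S by (intro borel_measurable_continuous_on_indicator) auto
  then show int': "set_integrable lborel S (\<lambda>s. \<bar>g' s\<bar> *\<^sub>R F (g s))"
    using *(1) unfolding set_integrable_def by (subst (asm) integrable_completion) auto
  show "(LINT s:S|lborel. \<bar>g' s\<bar> *\<^sub>R F (g s)) = (LINT u:T|lborel. F u)"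
    using *(2) set_borel_integral_eq_integral(2)[OF int'] set_borel_integral_eq_integral(2)[OF int] by simp
qed

text \<open>
  The intended \<open>S\<close> is a one-sided neighbourhood of a point at which \<open>\<Psi>\<close> vanishes: there \<open>1 / \<Psi>\<close>
  sweeps out a half-line and can serve as the new variable of integration.
\<close>

locale phase_substitution =
  fixes S :: "real set" and U :: real and \<Psi> \<Psi>' :: "real \<Rightarrow> real"
  assumes S: "open S" and U: "U > 0"
    and deriv: "\<And>s. s \<in> S \<Longrightarrow> (\<Psi> has_real_derivative \<Psi>' s) (at s)"
    and cont': "continuous_on S \<Psi>'"
    and pos: "\<And>s. s \<in> S \<Longrightarrow> \<Psi> s > 0" and pos': "\<And>s. s \<in> S \<Longrightarrow> \<Psi>' s > 0"
    and inj: "inj_on \<Psi> S" and img: "(\<lambda>s. inverse (\<Psi> s)) ` S = {U<..}"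
begin

definition kernel :: "real \<Rightarrow> real \<Rightarrow> real" where
  "kernel l s = (1 - exp (- inverse (\<Psi> s))) powr l"

lemma kernel_power_term:
  assumes "0 < Re z" "Re z < l"
  shows "set_integrable lborel S (\<lambda>s. of_real (kernel l s) * (of_real (\<Psi> s) powr (z - 1) * of_real (\<Psi>' s)) :: complex)"
    and "(LINT s:S|lborel. of_real (kernel l s) * (of_real (\<Psi> s) powr (z - 1) * of_real (\<Psi>' s)))
      = (LINT t:{U<..}|lborel. of_real t powr (- z - 1) * of_real ((1 - exp (- t)) powr l) :: complex)"
proof -
  let ?g' = "\<lambda>s. - (\<Psi>' s * inverse (\<Psi> s ^ 2))"
  let ?F = "\<lambda>t. of_real t powr (- z - 1) * of_real ((1 - exp (- t)) powr l) :: complex"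
  have cong: "\<bar>?g' s\<bar> *\<^sub>R ?F (inverse (\<Psi> s)) = of_real (kernel l s) * (of_real (\<Psi> s) powr (z - 1) * of_real (\<Psi>' s))"
    if s: "s \<in> S" for s
  proof -
    note p = pos[OF s] pos'[OF s]
    have "of_real (inverse (\<Psi> s)) powr (- z - 1) = (of_real (\<Psi> s) powr (z + 1) :: complex)"
      using p by (simp add: powr_def Ln_of_real ln_inverse algebra_simps del: of_real_inverse)
    also have "\<dots> = of_real (\<Psi> s) powr (z - 1) * of_real (\<Psi> s) ^ 2"
      using p powr_add[of "of_real (\<Psi> s) :: complex" "z - 1" 2] by (simp add: add.commute)
    finally show ?thesis
      using p by (simp add: kernel_def scaleR_conv_of_real abs_mult field_simps)
  qed
  have d: "((\<lambda>s. inverse (\<Psi> s)) has_real_derivative ?g' s) (at s)" if "s \<in> S" for s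
    using deriv[OF that] pos[OF that]
    by (auto intro!: derivative_eq_intros simp: power2_eq_square)
  have "continuous_on S \<Psi>"
    using deriv by (meson DERIV_isCont continuous_at_imp_continuous_on)
  then have c: "continuous_on S ?g'"
    using cont' pos by (intro continuous_intros) (auto simp: less_imp_neq[THEN not_sym])
  have F: "continuous_on {U<..} ?F"
    using U by (intro continuous_intros) auto
  have i: "set_integrable lborel {U<..} ?F"
    using U assms by (intro set_integrable_subset[OF mellin_beta_set_integrable]) auto
  have j: "inj_on (\<lambda>s. inverse (\<Psi> s)) S"
    using inj by (auto simp: inj_on_def)
  note sub = set_integral_substitution_open[OF S open_greaterThan d j img c F i]
  show "set_integrable lborel S (\<lambda>s. of_real (kernel l s) * (of_real (\<Psi> s) powr (z - 1) * of_real (\<Psi>' s)) :: complex)"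
    using sub(1) by (rule set_integrable_cong[THEN iffD1, rotated 3]) (auto simp only: cong)
  have "(LINT s:S|lborel. of_real (kernel l s) * (of_real (\<Psi> s) powr (z - 1) * of_real (\<Psi>' s)))
      = (LINT s:S|lborel. \<bar>?g' s\<bar> *\<^sub>R ?F (inverse (\<Psi> s)))"
    using S by (intro set_lebesgue_integral_cong) (auto simp only: cong sets_lborel borel_open)
  then show "(LINT s:S|lborel. of_real (kernel l s) * (of_real (\<Psi> s) powr (z - 1) * of_real (\<Psi>' s)))
      = (LINT t:{U<..}|lborel. ?F t)"
    using sub(2) by simp
qed

text \<open>
  The terms of the combination integrate to truncated Mellin integrals. The remainder is
  dominated by one more such term, with the real exponent \<open>\<sigma>\<close>, and the size of that term is known
  from \<open>mellin_beta_bigtheta\<close>.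
\<close>

lemma near_integral_asymp:
  fixes A :: "real \<Rightarrow> complex" and z d :: "nat \<Rightarrow> complex"
  assumes A: "continuous_on S A" and z: "\<And>n. n < N \<Longrightarrow> Re (z n) > 0" and \<sigma>: "\<sigma> > 0"
    and approx: "\<And>s. s \<in> S \<Longrightarrow> cmod (A s - (\<Sum>n<N. d n * (of_real (\<Psi> s) powr (z n - 1) * of_real (\<Psi>' s))))
      \<le> C * (\<Psi> s powr (\<sigma> - 1) * \<Psi>' s)"
  shows "(\<lambda>l. (LINT s:S|lborel. of_real (kernel l s) * A s) - (\<Sum>n<N. d n * mellin_beta (z n) (l - 1)))
    \<in> O[at_top](\<lambda>l. of_real (ln l powr (- \<sigma>)))"
proof -
  define r where "r s = A s - (\<Sum>n<N. d n * (of_real (\<Psi> s) powr (z n - 1) * of_real (\<Psi>' s)))" for s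
  define J where "J w l = (LINT t:{U<..}|lborel. of_real t powr (- w - 1) * of_real ((1 - exp (- t)) powr l) :: complex)" for w l
  \<comment> \<open>an exponent beyond which the Mellin integrals of all powers involved converge\<close>
  define l1 where "l1 = \<sigma> + (\<Sum>n<N. Re (z n))"
  have l1: "\<sigma> < l" "\<And>n. n < N \<Longrightarrow> Re (z n) < l" if "l > l1" for l
  proof -
    show "\<sigma> < l" using that sum_nonneg[of "{..<N}" "\<lambda>n. Re (z n)"] z by (force simp: l1_def)
    show "Re (z n) < l" if "n < N" for n
      using \<open>l > l1\<close> \<sigma> that z member_le_sum[of n "{..<N}" "\<lambda>n. Re (z n)"] by (force simp: l1_def)
  qed
  have cont: "continuous_on S \<Psi>"
    using deriv by (meson DERIV_isCont continuous_at_imp_continuous_on)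
  have "continuous_on S r"
    unfolding r_def by (intro continuous_intros A cont cont') (auto simp: complex_nonpos_Reals_iff dest: pos)
  moreover have "continuous_on S (kernel l)" for l
    unfolding kernel_def using pos by (intro continuous_intros cont) (auto simp: less_imp_neq[THEN not_sym])
  ultimately have contKr: "continuous_on S (\<lambda>s. of_real (kernel l s) * r s)" for l
    by (intro continuous_intros)
  have dom: "set_integrable lborel S (\<lambda>s. C *\<^sub>R (of_real (kernel l s) * (of_real (\<Psi> s) powr (of_real \<sigma> - 1) * of_real (\<Psi>' s)) :: complex))"
    if "l > l1" for l
    using kernel_power_term(1)[of "of_real \<sigma>" l] l1[OF that] \<sigma> by (intro set_integrable_scaleR_right) auto
  have bound: "cmod (of_real (kernel l s) * r s) \<le> cmod (C *\<^sub>R (of_real (kernel l s) * (of_real (\<Psi> s) powr (of_real \<sigma> - 1) * of_real (\<Psi>' s)) :: complex))"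
    if "s \<in> S" for s l
  proof -
    have "cmod (r s) \<le> \<bar>C\<bar> * (\<Psi> s powr (\<sigma> - 1) * \<Psi>' s)"
      using order_trans[OF approx[OF that] mult_right_mono[of C "\<bar>C\<bar>"]] pos'[OF that]
      by (simp add: r_def)
    then have "kernel l s * cmod (r s) \<le> kernel l s * (\<bar>C\<bar> * (\<Psi> s powr (\<sigma> - 1) * \<Psi>' s))"
      by (intro mult_left_mono) (auto simp: kernel_def)
    then show ?thesis
      using pos[OF that] pos'[OF that] by (simp add: norm_mult norm_powr_real_powr kernel_def mult_ac)
  qed
  have intr: "set_integrable lborel S (\<lambda>s. of_real (kernel l s) * r s)" if "l > l1" for l
  proof (rule set_integrable_bound[OF dom[OF that]])
    show "set_borel_measurable lborel S (\<lambda>s. of_real (kernel l s) * r s)"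
      unfolding set_borel_measurable_def using S contKr
      by (simp add: borel_measurable_continuous_on_indicator)
  qed (use bound in auto)
  have terms: "set_integrable lborel S (\<lambda>s. d n * (of_real (kernel l s) * (of_real (\<Psi> s) powr (z n - 1) * of_real (\<Psi>' s))))"
    if "l > l1" "n < N" for l n
    using kernel_power_term(1)[of "z n" l] l1[OF that(1)] z that by (intro set_integrable_mult_right) auto
  have split: "of_real (kernel l s) * A s =
      of_real (kernel l s) * r s + (\<Sum>n<N. d n * (of_real (kernel l s) * (of_real (\<Psi> s) powr (z n - 1) * of_real (\<Psi>' s))))" for l s
    by (simp add: r_def algebra_simps sum_distrib_left)
  have all: "(LINT s:S|lborel. of_real (kernel l s) * A s) = (LINT s:S|lborel. of_real (kernel l s) * r s) + (\<Sum>n<N. d n * J (z n) l)"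
    if "l > l1" for l
  proof -
    have s: "set_integrable lborel S (\<lambda>s. \<Sum>n<N. d n * (of_real (kernel l s) * (of_real (\<Psi> s) powr (z n - 1) * of_real (\<Psi>' s))))"
      unfolding set_integrable_def scaleR_sum_right
      using terms[OF that] by (intro Bochner_Integration.integrable_sum) (simp add: set_integrable_def)
    have "(LINT s:S|lborel. of_real (kernel l s) * A s) = (LINT s:S|lborel. of_real (kernel l s) * r s)
        + (LINT s:S|lborel. \<Sum>n<N. d n * (of_real (kernel l s) * (of_real (\<Psi> s) powr (z n - 1) * of_real (\<Psi>' s))))"
      unfolding split using intr[OF that] s by (rule set_integral_add)
    also have "(LINT s:S|lborel. \<Sum>n<N. d n * (of_real (kernel l s) * (of_real (\<Psi> s) powr (z n - 1) * of_real (\<Psi>' s))))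
        = (\<Sum>n<N. LINT s:S|lborel. d n * (of_real (kernel l s) * (of_real (\<Psi> s) powr (z n - 1) * of_real (\<Psi>' s))))"
      unfolding set_lebesgue_integral_def scaleR_sum_right
      using terms[OF that] by (intro Bochner_Integration.integral_sum) (simp add: set_integrable_def)
    also have "\<dots> = (\<Sum>n<N. d n * J (z n) l)"
      using kernel_power_term(2) l1[OF that] z by (intro sum.cong) (auto simp: J_def)
    finally show "(LINT s:S|lborel. of_real (kernel l s) * A s) = (LINT s:S|lborel. of_real (kernel l s) * r s) + (\<Sum>n<N. d n * J (z n) l)" .
  qed
  let ?G = "\<lambda>l. of_real (ln l powr (- \<sigma>)) :: complex"
  have trunc: "(\<lambda>l. mellin_beta w (l - 1) - J w l) \<in> O[at_top](?G)" if "Re w > 0" for w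
    unfolding J_def using that U by (rule mellin_beta_truncation)
  \<comment> \<open>the bound on the remainder is a term of the expansion with exponent \<open>\<sigma>\<close> and integrates to \<open>J \<sigma>\<close>\<close>
  have "(\<lambda>l. LINT s:S|lborel. of_real (kernel l s) * r s) \<in> O[at_top](\<lambda>l. J (of_real \<sigma>) l)"
  proof (rule bigoI[of _ "\<bar>C\<bar>"])
    show "\<forall>\<^sub>F l in at_top. cmod (LINT s:S|lborel. of_real (kernel l s) * r s) \<le> \<bar>C\<bar> * cmod (J (of_real \<sigma>) l)"
      using eventually_gt_at_top[of l1]
    proof eventually_elim
      case (elim l)
      have K: "of_real (kernel l s) * (of_real (\<Psi> s) powr (of_real \<sigma> - 1) * of_real (\<Psi>' s))
          = (of_real (kernel l s * (\<Psi> s powr (\<sigma> - 1) * \<Psi>' s)) :: complex)" if "s \<in> S" for s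
        using pos[OF that] by (simp flip: powr_of_real)
      have "cmod (LINT s:S|lborel. of_real (kernel l s) * r s)
          \<le> (LINT s|lborel. cmod (indicat_real S s *\<^sub>R (of_real (kernel l s) * r s)))"
        unfolding set_lebesgue_integral_def by (rule integral_norm_bound)
      also have "\<dots> \<le> (LINT s|lborel. cmod (indicat_real S s *\<^sub>R
          (C *\<^sub>R (of_real (kernel l s) * (of_real (\<Psi> s) powr (of_real \<sigma> - 1) * of_real (\<Psi>' s)) :: complex))))"
      proof (rule integral_mono')
        show "integrable lborel (\<lambda>s. cmod (indicat_real S s *\<^sub>R
          (C *\<^sub>R (of_real (kernel l s) * (of_real (\<Psi> s) powr (of_real \<sigma> - 1) * of_real (\<Psi>' s)) :: complex))))"
          using dom[OF elim] unfolding set_integrable_def by (rule integrable_norm)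
      qed (use bound in \<open>auto simp: indicator_def\<close>)
      also have "\<dots> = \<bar>C\<bar> * (LINT s:S|lborel. kernel l s * (\<Psi> s powr (\<sigma> - 1) * \<Psi>' s))"
        unfolding set_lebesgue_integral_def integral_mult_right_zero[symmetric]
      proof (rule Bochner_Integration.integral_cong[OF refl])
        fix s
        show "cmod (indicat_real S s *\<^sub>R (C *\<^sub>R (of_real (kernel l s) * (of_real (\<Psi> s) powr (of_real \<sigma> - 1) * of_real (\<Psi>' s)) :: complex)))
           = \<bar>C\<bar> * (indicat_real S s *\<^sub>R (kernel l s * (\<Psi> s powr (\<sigma> - 1) * \<Psi>' s)))"
          using pos'[of s] by (cases "s \<in> S") (simp_all add: K norm_mult, simp add: kernel_def abs_mult)
      qed
      also have "(LINT s:S|lborel. kernel l s * (\<Psi> s powr (\<sigma> - 1) * \<Psi>' s)) \<le>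
          cmod (of_real (LINT s:S|lborel. kernel l s * (\<Psi> s powr (\<sigma> - 1) * \<Psi>' s)))"
        by simp
      also have "of_real (LINT s:S|lborel. kernel l s * (\<Psi> s powr (\<sigma> - 1) * \<Psi>' s)) =
          (LINT s:S|lborel. (of_real (kernel l s * (\<Psi> s powr (\<sigma> - 1) * \<Psi>' s)) :: complex))"
        by (simp only: set_integral_complex_of_real)
      also have "\<dots> = (LINT s:S|lborel. of_real (kernel l s) * (of_real (\<Psi> s) powr (of_real \<sigma> - 1) * of_real (\<Psi>' s)))"
        using S by (intro set_lebesgue_integral_cong) (auto simp only: K sets_lborel borel_open)
      also have "\<dots> = J (of_real \<sigma>) l"
        using l1[OF elim] \<sigma> by (simp add: kernel_power_term(2) J_def)
      finally show ?case by (simp add: mult_left_mono)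
    qed
  qed
  also have "(\<lambda>l. J (of_real \<sigma>) l) \<in> O[at_top](?G)"
  proof -
    have "(\<lambda>l. mellin_beta (of_real \<sigma>) (l - 1)) \<in> O[at_top](?G)"
      using mellin_beta_bigtheta[of "of_real \<sigma>"] \<sigma> by (auto dest: bigthetaD1)
    from sum_in_bigo(2)[OF this trunc[of "of_real \<sigma>"]] \<sigma> show ?thesis by simp
  qed
  finally have rem: "(\<lambda>l. LINT s:S|lborel. of_real (kernel l s) * r s) \<in> O[at_top](?G)" .
  \<comment> \<open>replacing the truncated integrals by full ones costs only negligible terms\<close>
  have "(\<lambda>l. \<Sum>n<N. d n * (mellin_beta (z n) (l - 1) - J (z n) l)) \<in> O[at_top](?G)"
    using trunc z by (intro big_sum_in_bigo landau_o.big.cmult_in_iff') (auto simp: landau_o.big.cmult_in_iff')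
  from sum_in_bigo(2)[OF rem this]
  have "(\<lambda>l. (LINT s:S|lborel. of_real (kernel l s) * r s) - (\<Sum>n<N. d n * (mellin_beta (z n) (l - 1) - J (z n) l))) \<in> O[at_top](?G)" .
  moreover have "\<forall>\<^sub>F l in at_top. (LINT s:S|lborel. of_real (kernel l s) * r s) - (\<Sum>n<N. d n * (mellin_beta (z n) (l - 1) - J (z n) l))
      = (LINT s:S|lborel. of_real (kernel l s) * A s) - (\<Sum>n<N. d n * mellin_beta (z n) (l - 1))"
    using eventually_gt_at_top[of l1]
    by eventually_elim (simp add: all right_diff_distrib sum_subtractf)
  ultimately show "(\<lambda>l. (LINT s:S|lborel. of_real (kernel l s) * A s) - (\<Sum>n<N. d n * mellin_beta (z n) (l - 1)))
    \<in> O[at_top](?G)"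
    by (simp cong: landau_o.big.in_cong)
qed

end

section \<open>Points away from the endpoint\<close>

lemma open_segm: "open (segm t0 T)"
  by (simp add: segm_def)

text \<open>
  Continuity alone does not exclude that \<open>\<phi>\<close> approaches 0 towards the far end, which may be
  infinite. In the extended reals the segment with a neighbourhood of \<open>t0\<close> removed and \<open>T\<close> added
  is compact, and \<open>\<phi>\<close> is locally bounded below at each of its points, at \<open>T\<close> because of the limit.
\<close>

lemma phase_bounded_below_off_endpoint:
  fixes \<phi> :: "real \<Rightarrow> real"
  assumes T: "T \<noteq> ereal t0" and "\<delta> > 0"
    and cont: "continuous_on (segm t0 T) \<phi>" and pos: "\<And>t. t \<in> segm t0 T \<Longrightarrow> \<phi> t > 0"
    and lim: "((\<lambda>t. ereal (\<phi> t)) \<longlongrightarrow> \<phi>_T) (tending_within T (segm t0 T))" and "\<phi>_T > 0"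
  shows "\<exists>m>0. \<forall>t\<in>segm t0 T - segm_near t0 T \<delta>. m \<le> \<phi> t"
proof -
  define X where "X = {min (ereal t0) T..max (ereal t0) T} - ereal ` {t0 - \<delta><..<t0 + \<delta>}"
  have "closed X"
    unfolding X_def by (intro closed_Diff open_ereal) auto
  then have X: "compact X"
    using compact_eq_closed by blast
  have loc: "\<exists>W m. open W \<and> x \<in> W \<and> m > 0 \<and> (\<forall>t\<in>segm t0 T. ereal t \<in> W \<longrightarrow> m \<le> \<phi> t)" if x: "x \<in> X" for x
  proof (cases "x = T")
    case True
    obtain m where m: "0 < ereal m" "ereal m < \<phi>_T"
      using ereal_dense2[OF \<open>\<phi>_T > 0\<close>] by auto
    from order_tendstoD(1)[OF lim m(2)]
    obtain W where "open W" "T \<in> W" "\<And>t. ereal t \<in> W \<Longrightarrow> t \<in> segm t0 T \<Longrightarrow> m < \<phi> t"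
      by (auto simp: tending_within_def eventually_inf_principal eventually_filtercomap eventually_nhds)
    then show ?thesis using True m(1) by (intro exI[of _ W] exI[of _ m]) (auto intro: less_imp_le)
  next
    case False
    then have "x \<noteq> ereal t0" "min (ereal t0) T < x" "x < max (ereal t0) T"
      using x \<open>\<delta> > 0\<close> by (auto simp: X_def less_le min_def max_def split: if_splits)
    then obtain t where t: "x = ereal t" "t \<in> segm t0 T"
      by (cases x) (auto simp: segm_def einterval_def)
    have "isCont \<phi> t"
      using cont t(2) open_segm by (simp add: continuous_on_eq_continuous_at)
    then have "\<forall>\<^sub>F s in nhds t. \<phi> t / 2 < \<phi> s"
      using pos[OF t(2)] by (intro order_tendstoD) (auto simp: continuous_at_imp_continuous_at_within isCont_def tendsto_at_iff_tendsto_nhds)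
    then obtain S where S: "open S" "t \<in> S" "\<And>s. s \<in> S \<Longrightarrow> \<phi> t / 2 < \<phi> s"
      by (auto simp: eventually_nhds)
    then show ?thesis
      using t pos[OF t(2)] by (intro exI[of _ "ereal ` S"] exI[of _ "\<phi> t / 2"]) (auto intro: open_ereal less_imp_le)
  qed
  then obtain W m where W: "\<And>x. x \<in> X \<Longrightarrow> open (W x)" "\<And>x. x \<in> X \<Longrightarrow> x \<in> W x" "\<And>x. x \<in> X \<Longrightarrow> m x > (0::real)"
    "\<And>x t. x \<in> X \<Longrightarrow> t \<in> segm t0 T \<Longrightarrow> ereal t \<in> W x \<Longrightarrow> m x \<le> \<phi> t"
    by metis
  obtain C where C: "C \<subseteq> X" "finite C" "X \<subseteq> (\<Union>c\<in>C. W c)"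
    by (rule compactE_image[OF X, of X W]) (use W(1,2) in auto)
  show ?thesis
  proof (intro exI conjI ballI)
    show "Min (insert 1 (m ` C)) > 0"
      using C W by (subst Min_gr_iff) auto
    fix t assume t: "t \<in> segm t0 T - segm_near t0 T \<delta>"
    then have "ereal t \<in> X"
      by (auto simp: X_def segm_def segm_near_def einterval_def)
    then obtain c where "c \<in> C" "ereal t \<in> W c"
      using C by auto
    then show "Min (insert 1 (m ` C)) \<le> \<phi> t"
      using W(4)[of c t] C t by (intro order_trans[OF Min_le[of _ "m c"]]) auto
  qed
qed

section \<open>Asymptotics of the integral near the endpoint\<close>

lemma chi_diff: "chi \<alpha> \<beta> n - chi \<alpha> \<beta> m = (of_nat n - of_nat m) / of_real \<beta>"
  by (simp add: chi_def diff_divide_distrib add_divide_distrib)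

lemma Re_chi_pos: "Re \<alpha> > -1 \<Longrightarrow> \<beta> > 0 \<Longrightarrow> Re (chi \<alpha> \<beta> n) > 0"
  by (simp add: chi_def)

text \<open>
  For \<open>\<Psi> = s powr \<beta> * exp \<eta>\<close> and \<open>D = \<beta> + s * \<eta>'\<close> the left-hand side is \<open>\<Psi> powr (\<chi>\<^sub>n - 1) * \<Psi>'\<close>;
  the exponents of \<open>s\<close> add up to \<open>\<beta> * \<chi>\<^sub>n - 1 = \<alpha> + n\<close>. This identifies the summands of
  \<open>analytic_expansion_in_powers\<close> with the forms that the substitution can integrate.
\<close>

lemma powr_phase_term:
  fixes \<alpha> :: complex and \<beta> s \<eta> D :: real
  assumes s: "s > 0" and \<beta>: "\<beta> > 0"
  shows "of_real (s powr \<beta> * exp \<eta>) powr (chi \<alpha> \<beta> n - 1) * of_real (s powr (\<beta> - 1) * exp \<eta> * D)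
    = of_real s powr \<alpha> * (of_real s ^ n * (exp (chi \<alpha> \<beta> n * of_real \<eta>) * of_real D))"
proof -
  define \<zeta> where "\<zeta> = chi \<alpha> \<beta> n"
  have e: "of_real \<beta> * \<zeta> = \<alpha> + 1 + of_nat n"
    using \<beta> by (simp add: \<zeta>_def chi_def)
  have "s powr \<beta> * exp \<eta> = exp (\<beta> * ln s + \<eta>)" "s powr (\<beta> - 1) * exp \<eta> = exp ((\<beta> - 1) * ln s + \<eta>)"
    using s by (simp_all add: powr_def exp_add)
  moreover have "of_real (exp x) powr z = (exp (z * of_real x) :: complex)" for x z
    by (simp add: powr_def Ln_of_real del: of_real_exp)
  ultimately have "of_real (s powr \<beta> * exp \<eta>) powr (\<zeta> - 1) * of_real (s powr (\<beta> - 1) * exp \<eta> * D)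
      = exp ((\<zeta> - 1) * of_real (\<beta> * ln s + \<eta>)) * (exp (of_real ((\<beta> - 1) * ln s + \<eta>)) * of_real D)"
    by (simp only: of_real_mult exp_of_real)
  also have "\<dots> = exp ((\<zeta> - 1) * of_real (\<beta> * ln s + \<eta>) + of_real ((\<beta> - 1) * ln s + \<eta>)) * of_real D"
    by (simp only: exp_add mult.assoc)
  also have "(\<zeta> - 1) * of_real (\<beta> * ln s + \<eta>) + of_real ((\<beta> - 1) * ln s + \<eta>)
      = (of_real \<beta> * \<zeta> - 1) * of_real (ln s) + \<zeta> * of_real \<eta>"
    by (simp add: algebra_simps)
  also have "\<dots> = \<alpha> * of_real (ln s) + of_nat n * of_real (ln s) + \<zeta> * of_real \<eta>"
    unfolding e by (simp add: algebra_simps)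
  also have "exp \<dots> * of_real D = of_real s powr \<alpha> * (of_real s ^ n * (exp (\<zeta> * of_real \<eta>) * of_real D))"
    using s by (simp add: exp_add powr_def Ln_of_real exp_of_nat_mult exp_of_real mult_ac)
  finally show ?thesis by (simp only: \<zeta>_def)
qed

lemma has_real_derivative_of_real_valued:
  assumes h: "h holomorphic_on X" "open X" and S: "open S" "s \<in> S"
    and sub: "of_real ` S \<subseteq> X" and real: "\<And>t. t \<in> S \<Longrightarrow> h (of_real t) \<in> \<real>"
  shows "((\<lambda>t. Re (h (of_real t))) has_real_derivative Re (deriv h (of_real s))) (at s)"
    and "deriv h (of_real s) \<in> \<real>"
proof -
  have "(h has_field_derivative deriv h (of_real s)) (at (of_real s))"
    using h S sub by (intro holomorphic_derivI[of _ X]) auto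
  then have d: "((\<lambda>t. h (of_real t)) has_vector_derivative deriv h (of_real s)) (at s)"
    by (rule has_vector_derivative_real_field)
  show "((\<lambda>t. Re (h (of_real t))) has_real_derivative Re (deriv h (of_real s))) (at s)"
    using bounded_linear.has_vector_derivative[OF bounded_linear_Re d]
    by (simp add: has_real_derivative_iff_has_vector_derivative)
  have "((\<lambda>t. Im (h (of_real t))) has_vector_derivative Im (deriv h (of_real s))) (at s)"
    by (rule bounded_linear.has_vector_derivative[OF bounded_linear_Im d])
  then have "((\<lambda>t. 0 :: real) has_vector_derivative Im (deriv h (of_real s))) (at s)"
    by (rule has_vector_derivative_transform_within_open[OF _ S]) (use real in \<open>auto simp: complex_is_Real_iff\<close>)
  then have "Im (deriv h (of_real s)) = 0"
    using vector_derivative_unique_at has_vector_derivative_const by blast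
  then show "deriv h (of_real s) \<in> \<real>"
    by (simp add: complex_is_Real_iff)
qed

text \<open>
  The analytic expansion holds in a small disc. Shrinking the interval further makes \<open>\<beta> + s * h'\<close>
  positive, so that \<open>\<Psi>\<close> is increasing and \<open>1 / \<Psi>\<close> maps the interval onto a half-line.
\<close>

lemma local_integral_expansion:
  fixes h q :: "complex \<Rightarrow> complex" and \<alpha> :: complex and \<beta> \<delta>0 :: real
  assumes \<alpha>: "Re \<alpha> > -1" and \<beta>: "\<beta> > 0" and h: "h analytic_on {0}" and q: "q analytic_on {0}"
    and \<delta>0: "\<delta>0 > 0" and real: "\<And>s. 0 < s \<Longrightarrow> s < \<delta>0 \<Longrightarrow> h (of_real s) \<in> \<real>"
  defines "\<Psi> \<equiv> \<lambda>s. s powr \<beta> * exp (Re (h (of_real s)))"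
    and "d \<equiv> \<lambda>n. (deriv ^^ n) (\<lambda>w. q w * exp (- chi \<alpha> \<beta> n * h w)) 0 / fact n / of_real \<beta>"
  shows "\<exists>\<delta>>0. \<delta> \<le> \<delta>0 \<and>
    (\<lambda>l. (LINT s:{0<..<\<delta>}|lborel. of_real ((1 - exp (- inverse (\<Psi> s))) powr l) * (of_real s powr \<alpha> * q (of_real s)))
        - (\<Sum>n<N. d n * mellin_beta (chi \<alpha> \<beta> n) (l - 1)))
      \<in> O[at_top](\<lambda>l. of_real (ln l powr (- Re (chi \<alpha> \<beta> N))))"
proof -
  define g where "g w = of_real \<beta> + w * deriv h w" for w
  obtain C where C: "\<forall>\<^sub>F w in at 0. cmod (q w - (\<Sum>n<N. d n * (w ^ n * (exp (chi \<alpha> \<beta> n * h w) * g w))))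
      \<le> C * cmod (w ^ N * (exp (chi \<alpha> \<beta> N * h w) * g w))"
    using analytic_expansion_in_powers[OF h q, of "of_real \<beta>" "chi \<alpha> \<beta>" N] \<beta> chi_diff
    unfolding g_def d_def by auto
  have cont_deriv: "isCont (deriv h) 0"
    using h by (intro analytic_at_imp_isCont analytic_deriv)
  have "isCont (\<lambda>w. Re (g w)) 0"
    unfolding g_def by (intro continuous_Re continuous_intros cont_deriv)
  then have "\<forall>\<^sub>F w in at 0. Re (g w) > 0"
    using \<beta> by (auto simp: isCont_def g_def intro: order_tendstoD)
  with C have "\<forall>\<^sub>F w in at 0. cmod (q w - (\<Sum>n<N. d n * (w ^ n * (exp (chi \<alpha> \<beta> n * h w) * g w))))
      \<le> C * cmod (w ^ N * (exp (chi \<alpha> \<beta> N * h w) * g w)) \<and> Re (g w) > 0"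
    by (rule eventually_conj)
  then obtain e1 where e1: "e1 > 0" and near: "\<And>w. w \<noteq> 0 \<Longrightarrow> cmod w < e1 \<Longrightarrow>
      cmod (q w - (\<Sum>n<N. d n * (w ^ n * (exp (chi \<alpha> \<beta> n * h w) * g w))))
      \<le> C * cmod (w ^ N * (exp (chi \<alpha> \<beta> N * h w) * g w))" "\<And>w. w \<noteq> 0 \<Longrightarrow> cmod w < e1 \<Longrightarrow> Re (g w) > 0"
    unfolding eventually_at by (auto simp: dist_norm)
  obtain e2 where e2: "e2 > 0" "h holomorphic_on ball 0 e2"
    using h by (auto simp: analytic_on_def)
  obtain e3 where e3: "e3 > 0" "q holomorphic_on ball 0 e3"
    using q by (auto simp: analytic_on_def)
  define \<delta>1 where "\<delta>1 = Min {e1, e2, e3, \<delta>0}"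
  have \<delta>1: "\<delta>1 > 0" "\<delta>1 \<le> e1" "\<delta>1 \<le> e2" "\<delta>1 \<le> e3" "\<delta>1 \<le> \<delta>0"
    using e1 e2 e3 \<delta>0 by (auto simp: \<delta>1_def)
  \<comment> \<open>\<open>\<delta>\<close> stays below \<open>\<delta>1\<close> so that \<open>\<Psi>\<close> is still monotone and continuous at \<open>\<delta>\<close>, which gives the image its exact endpoint\<close>
  define \<delta> where "\<delta> = \<delta>1 / 2"
  have \<delta>: "0 < \<delta>" "\<delta> < \<delta>1" using \<delta>1 by (auto simp: \<delta>_def)
  define \<eta> where "\<eta> s = Re (h (of_real s))" for s
  define \<Psi>' where "\<Psi>' s = s powr (\<beta> - 1) * exp (\<eta> s) * Re (g (of_real s))" for s
  define A where "A s = of_real s powr \<alpha> * q (of_real s)" for s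
  have sub: "of_real ` {0<..<\<delta>1} \<subseteq> ball (0::complex) e2" "of_real ` {0<..<\<delta>1} \<subseteq> ball (0::complex) e3"
    using \<delta>1 by auto
  have d\<eta>: "(\<eta> has_real_derivative Re (deriv h (of_real s))) (at s)" "deriv h (of_real s) \<in> \<real>"
    if "s \<in> {0<..<\<delta>1}" for s
    unfolding \<eta>_def
    using has_real_derivative_of_real_valued[OF e2(2) open_ball open_greaterThanLessThan that sub(1)] real \<delta>1
    by auto
  have hr: "h (of_real s) = of_real (\<eta> s)" and gr: "g (of_real s) = of_real (Re (g (of_real s)))"
    if "s \<in> {0<..<\<delta>1}" for s
  proof -
    show "h (of_real s) = of_real (\<eta> s)"
      using real[of s] that \<delta>1 by (simp add: \<eta>_def of_real_Re)
    have "g (of_real s) \<in> \<real>"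
      using d\<eta>(2)[OF that] by (simp add: g_def)
    then show "g (of_real s) = of_real (Re (g (of_real s)))" by (simp add: of_real_Re)
  qed
  have \<Psi>_eq: "\<Psi> s = s powr \<beta> * exp (\<eta> s)" for s
    by (simp add: \<Psi>_def \<eta>_def)
  have d\<Psi>: "(\<Psi> has_real_derivative \<Psi>' s) (at s)" if "s \<in> {0<..<\<delta>1}" for s
  proof -
    have "(\<Psi> has_real_derivative (\<beta> * s powr (\<beta> - 1) * exp (\<eta> s) + exp (\<eta> s) * Re (deriv h (of_real s)) * s powr \<beta>)) (at s)"
      unfolding \<Psi>_eq using that d\<eta>(1)[OF that] by (auto intro!: derivative_eq_intros)
    moreover have "s powr \<beta> = s * s powr (\<beta> - 1)"
      using that by (simp add: powr_diff)
    moreover have "Re (g (of_real s)) = \<beta> + s * Re (deriv h (of_real s))"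
      by (simp add: g_def)
    ultimately show ?thesis by (simp add: \<Psi>'_def algebra_simps)
  qed
  have \<Psi>'_pos: "\<Psi>' s > 0" if "s \<in> {0<..<\<delta>1}" for s
    using that near(2)[of "of_real s"] \<delta>1 by (simp add: \<Psi>'_def)
  have mono: "\<Psi> s < \<Psi> t" if "0 < s" "s < t" "t < \<delta>1" for s t
  proof (rule DERIV_pos_imp_increasing[OF that(2)])
    fix x assume "s \<le> x" "x \<le> t"
    then have "x \<in> {0<..<\<delta>1}" using that by simp
    then show "\<exists>y. (\<Psi> has_real_derivative y) (at x) \<and> y > 0"
      using d\<Psi> \<Psi>'_pos by blast
  qed
  have \<Psi>_pos: "\<Psi> s > 0" if "s > 0" for s
    using that by (simp add: \<Psi>_eq)
  have lim: "(\<Psi> \<longlongrightarrow> 0) (at_right 0)"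
  proof -
    have "isCont h 0" using h by (rule analytic_at_imp_isCont)
    then have "isCont (\<lambda>s. exp (\<eta> s)) 0"
      unfolding \<eta>_def by (intro isCont_exp' continuous_Re isCont_o2[of 0 of_real h]) auto
    then have "((\<lambda>s. exp (\<eta> s)) \<longlongrightarrow> exp (\<eta> 0)) (at_right 0)"
      unfolding isCont_def by (rule tendsto_within_subset) auto
    moreover have "((\<lambda>s. s powr \<beta>) \<longlongrightarrow> 0) (at_right 0)"
      using \<beta> by real_asymp
    ultimately have "((\<lambda>s. s powr \<beta> * exp (\<eta> s)) \<longlongrightarrow> 0 * exp (\<eta> 0)) (at_right 0)"
      by (intro tendsto_mult)
    then show ?thesis
      unfolding \<Psi>_eq by simp
  qed
  have img: "(\<lambda>s. inverse (\<Psi> s)) ` {0<..<\<delta>} = {inverse (\<Psi> \<delta>)<..}"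
  proof (intro equalityI subsetI)
    fix u assume "u \<in> (\<lambda>s. inverse (\<Psi> s)) ` {0<..<\<delta>}"
    then obtain s where s: "u = inverse (\<Psi> s)" "0 < s" "s < \<delta>" by auto
    then show "u \<in> {inverse (\<Psi> \<delta>)<..}"
      using mono[OF s(2,3) \<delta>(2)] \<Psi>_pos[OF s(2)] by (simp add: less_imp_inverse_less)
  next
    fix u assume "u \<in> {inverse (\<Psi> \<delta>)<..}"
    then have u': "inverse (\<Psi> \<delta>) < u" "0 < inverse (\<Psi> \<delta>)"
      using \<Psi>_pos[OF \<delta>(1)] by auto
    then have u: "u > 0" "inverse u < \<Psi> \<delta>"
      using less_imp_inverse_less[OF u'] less_trans[OF u'(2,1)] by auto
    have "\<forall>\<^sub>F s in at_right 0. \<Psi> s < inverse u \<and> s \<in> {0<..<\<delta>}"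
      using u by (intro eventually_conj order_tendstoD(2)[OF lim] eventually_at_right_real \<delta>) auto
    then obtain s0 where s0: "\<Psi> s0 < inverse u" "0 < s0" "s0 < \<delta>"
      using eventually_happens'[OF trivial_limit_at_right_real] by fastforce
    have "\<exists>s\<ge>s0. s \<le> \<delta> \<and> \<Psi> s = inverse u"
    proof (intro IVT allI impI)
      fix x assume "s0 \<le> x \<and> x \<le> \<delta>"
      then have "x \<in> {0<..<\<delta>1}" using s0 \<delta> by simp
      then show "isCont \<Psi> x" by (rule DERIV_isCont[OF d\<Psi>])
    qed (use s0 u in auto)
    then obtain s where s: "s0 \<le> s" "s \<le> \<delta>" "\<Psi> s = inverse u" by auto
    then have "s < \<delta>" using u by (cases "s = \<delta>") auto
    then show "u \<in> (\<lambda>s. inverse (\<Psi> s)) ` {0<..<\<delta>}"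
      using s s0 by (intro image_eqI[of _ _ s]) auto
  qed
  interpret phase_substitution "{0<..<\<delta>}" "inverse (\<Psi> \<delta>)" \<Psi> \<Psi>'
  proof
    have 1: "continuous_on (ball 0 e2) (deriv h)"
      using e2 by (intro holomorphic_on_imp_continuous_on holomorphic_deriv) auto
    have 2: "continuous_on {0<..<\<delta>} (\<lambda>s. deriv h (of_real s))"
      by (rule continuous_on_compose2[OF 1]) (use sub(1) \<delta> in \<open>auto intro!: continuous_intros\<close>)
    have 3: "continuous_on {0<..<\<delta>} \<eta>"
    proof (rule continuous_at_imp_continuous_on, rule ballI)
      fix s assume "s \<in> {0<..<\<delta>}"
      then show "isCont \<eta> s" using \<delta> by (intro DERIV_isCont[OF d\<eta>(1)]) simp
    qed
    show "continuous_on {0<..<\<delta>} \<Psi>'"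
      unfolding \<Psi>'_def g_def by (intro continuous_intros 2 3) auto
    show "inj_on \<Psi> {0<..<\<delta>}"
    proof (rule linorder_inj_onI)
      fix s t assume "s < t" "s \<in> {0<..<\<delta>}" "t \<in> {0<..<\<delta>}"
      then show "\<Psi> s \<noteq> \<Psi> t" using mono[of s t] \<delta> by simp
    qed auto
  qed (use \<Psi>_pos \<Psi>'_pos d\<Psi> \<delta> img in auto)
  have "(\<lambda>l. (LINT s:{0<..<\<delta>}|lborel. of_real (kernel l s) * A s) - (\<Sum>n<N. d n * mellin_beta (chi \<alpha> \<beta> n) (l - 1)))
      \<in> O[at_top](\<lambda>l. of_real (ln l powr (- Re (chi \<alpha> \<beta> N))))"
  proof (rule near_integral_asymp)
    have 1: "continuous_on (ball 0 e3) q"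
      using e3 by (intro holomorphic_on_imp_continuous_on)
    have 2: "continuous_on {0<..<\<delta>} (\<lambda>s. q (of_real s))"
      by (rule continuous_on_compose2[OF 1]) (use sub(2) \<delta> in \<open>auto intro!: continuous_intros\<close>)
    show "continuous_on {0<..<\<delta>} A"
      unfolding A_def by (intro continuous_intros 2) (auto simp: complex_nonpos_Reals_iff)
    show "Re (chi \<alpha> \<beta> n) > 0" for n
      using \<alpha> \<beta> by (rule Re_chi_pos)
    then show "Re (chi \<alpha> \<beta> N) > 0" .
    fix s assume "s \<in> {0<..<\<delta>}"
    then have s: "s \<in> {0<..<\<delta>1}" "s > 0" using \<delta> by auto
    let ?w = "of_real s :: complex"
    have tm: "of_real (\<Psi> s) powr (chi \<alpha> \<beta> n - 1) * of_real (\<Psi>' s)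
        = ?w powr \<alpha> * (?w ^ n * (exp (chi \<alpha> \<beta> n * h ?w) * g ?w))" for n
      unfolding hr[OF s(1)] \<Psi>'_def \<Psi>_eq by (simp only: powr_phase_term[OF s(2) \<beta>] gr[OF s(1), symmetric])
    have "cmod (A s - (\<Sum>n<N. d n * (of_real (\<Psi> s) powr (chi \<alpha> \<beta> n - 1) * of_real (\<Psi>' s))))
        = cmod (?w powr \<alpha>) * cmod (q ?w - (\<Sum>n<N. d n * (?w ^ n * (exp (chi \<alpha> \<beta> n * h ?w) * g ?w))))"
      unfolding tm A_def norm_mult[symmetric] by (simp add: right_diff_distrib sum_distrib_left mult_ac)
    also have "\<dots> \<le> cmod (?w powr \<alpha>) * (C * cmod (?w ^ N * (exp (chi \<alpha> \<beta> N * h ?w) * g ?w)))"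
      using near(1)[of ?w] s \<delta>1 by (intro mult_left_mono) auto
    also have "\<dots> = C * cmod (of_real (\<Psi> s) powr (chi \<alpha> \<beta> N - 1) * of_real (\<Psi>' s))"
      unfolding tm by (simp only: norm_mult mult_ac)
    also have "\<dots> = C * (\<Psi> s powr (Re (chi \<alpha> \<beta> N) - 1) * \<Psi>' s)"
      using \<Psi>_pos[OF s(2)] \<Psi>'_pos[OF s(1)] by (simp add: norm_mult norm_powr_real_powr)
    finally show "cmod (A s - (\<Sum>n<N. d n * (of_real (\<Psi> s) powr (chi \<alpha> \<beta> n - 1) * of_real (\<Psi>' s))))
      \<le> C * (\<Psi> s powr (Re (chi \<alpha> \<beta> N) - 1) * \<Psi>' s)" .
  qed
  then show ?thesis
    unfolding kernel_def A_def using \<delta> \<delta>1 by (intro exI[of _ \<delta>]) auto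
qed

section \<open>Reflecting the segment onto the positive half-line\<close>

text \<open>
  On the segment \<open>\<psi>\<close> is positive and \<open>(t - t0) powr \<beta>0\<close> has argument \<open>\<beta>0 * \<omega>\<close>, so the rotated factor
  \<open>p * cis (\<beta>0 * \<omega>)\<close> is a positive real. At \<open>t0\<close> itself this follows by continuity from
  \<open>p t0 \<noteq> 0\<close>.
\<close>

lemma rotated_factor_positive:
  assumes F: "factorization t0 T a \<psi> R \<alpha>0 \<beta>0 q p" and T: "T \<noteq> ereal t0"
    and t: "t \<in> insert t0 (segm_near t0 T R)"
  shows "p (of_real t) * cis (\<beta>0 * omega t0 T) = of_real (cmod (p (of_real t)))" and "p (of_real t) \<noteq> 0"
proof -
  define \<theta> where "\<theta> = \<beta>0 * omega t0 T"
  have on: "p (of_real s) * cis \<theta> = of_real (cmod (p (of_real s))) \<and> p (of_real s) \<noteq> 0"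
    if s: "s \<in> segm_near t0 T R" for s
  proof -
    have pos: "\<psi> s > 0" and eq: "of_real (\<psi> s) = segm_power t0 T (of_real \<beta>0) s * p (of_real s)"
      using F s by (auto simp: factorization_def)
    have ne: "s \<noteq> t0" using s
      by (auto simp: segm_near_def segm_def einterval_def min_def max_def split: if_splits)
    have "segm_power t0 T (of_real \<beta>0) s = of_real (\<bar>s - t0\<bar> powr \<beta>0) * cis \<theta>"
      using ne by (simp add: segm_power_def powr_of_real cis_conv_exp \<theta>_def mult_ac)
    then have g: "p (of_real s) * cis \<theta> = of_real (\<psi> s / \<bar>s - t0\<bar> powr \<beta>0)"
      using eq ne by (simp add: field_simps)
    have "cmod (p (of_real s)) = cmod (p (of_real s) * cis \<theta>)"
      by (simp add: norm_mult)
    also have "\<dots> = \<psi> s / \<bar>s - t0\<bar> powr \<beta>0"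
      unfolding g norm_of_real using pos by simp
    finally show ?thesis
      using g pos ne by auto
  qed
  have R: "R > 0" and p0: "p (of_real t0) \<noteq> 0" and pan: "p analytic_on {of_real t0}"
    using F by (auto simp: factorization_def elim: analytic_on_subset)
  define k where "k w = p w * cis \<theta> - of_real (cmod (p w))" for w
  have cont_p: "isCont p (of_real t0)"
    using pan by (rule analytic_at_imp_isCont)
  have "isCont k (of_real t0)"
    unfolding k_def by (intro continuous_intros cont_p)
  then have "(k \<longlongrightarrow> k (of_real t0)) (at (of_real t0) within of_real ` segm_near t0 T R)"
    unfolding isCont_def by (rule tendsto_within_subset) auto
  moreover have "(k \<longlongrightarrow> 0) (at (of_real t0) within of_real ` segm_near t0 T R)"
    by (rule tendsto_eventually) (use on in \<open>auto simp: k_def eventually_at_filter intro!: always_eventually\<close>)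
  moreover have "at (of_real t0 :: complex) within of_real ` segm_near t0 T R \<noteq> bot"
    using of_real_segm_near_islimpt[OF T R] trivial_limit_within by blast
  ultimately have "k (of_real t0) = 0"
    using tendsto_unique by blast
  then show "p (of_real t) * cis (\<beta>0 * omega t0 T) = of_real (cmod (p (of_real t)))" "p (of_real t) \<noteq> 0"
    using t on p0 by (auto simp: k_def \<theta>_def)
qed

text \<open>
  The rotated factor is positive at \<open>t0\<close>, so the principal logarithm is analytic there and provides
  a concrete branch; uniqueness of germs identifies it with the chosen one.
\<close>

lemma p_power_germ:
  assumes F: "factorization t0 T a \<psi> R \<alpha>0 \<beta>0 q p" and T: "T \<noteq> ereal t0"
  shows "\<forall>\<^sub>F w in nhds (of_real t0). p_power t0 T R \<beta>0 p \<kappa> w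
    = exp (\<kappa> * Ln (p w * cis (\<beta>0 * omega t0 T))) * exp (- \<i> * \<kappa> * of_real (\<beta>0 * omega t0 T))"
proof (rule power_branch_germ_unique[OF p_power_branch[OF F T] _ T])
  show "R > 0" using F by (simp add: factorization_def)
  let ?\<theta> = "\<beta>0 * omega t0 T"
  note pos = rotated_factor_positive[OF F T]
  have "p analytic_on {of_real t0}"
    using F by (auto simp: factorization_def elim: analytic_on_subset)
  moreover have "p (of_real t0) * cis ?\<theta> \<notin> \<real>\<^sub>\<le>\<^sub>0"
    using pos[of t0] by (simp del: of_real_mult)
  ultimately have "(\<lambda>w. exp (\<kappa> * Ln (p w * cis ?\<theta>)) * exp (- \<i> * \<kappa> * of_real ?\<theta>)) analytic_on {of_real t0}"
    by (intro analytic_intros) auto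
  moreover have "exp (\<kappa> * Ln (p (of_real t) * cis ?\<theta>)) = of_real (cmod (p (of_real t))) powr \<kappa>"
    if "t \<in> insert t0 (segm_near t0 T R)" for t
    using pos[OF that] by (simp add: powr_def)
  ultimately show "power_branch t0 T R \<beta>0 p \<kappa> (\<lambda>w. exp (\<kappa> * Ln (p w * cis ?\<theta>)) * exp (- \<i> * \<kappa> * of_real ?\<theta>))"
    unfolding power_branch_def by auto
qed

definition direction :: "real \<Rightarrow> ereal \<Rightarrow> real" where
  "direction t0 T = (if T > ereal t0 then 1 else -1)"

lemma direction_cases: "direction t0 T = 1 \<or> direction t0 T = -1"
  by (simp add: direction_def)

lemma exp_omega: "exp (\<i> * of_real (omega t0 T)) = of_real (direction t0 T)"
  by (simp add: direction_def omega_def)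

text \<open>
  Near \<open>t0\<close> the far endpoint \<open>T\<close> is not felt, and \<open>s = \<bar>t - t0\<bar>\<close> parametrises the segment.
\<close>

lemma segm_near_eq_image:
  assumes T: "T \<noteq> ereal t0"
  shows "\<exists>\<rho>>0. \<forall>r\<le>\<rho>. \<forall>s. t0 + direction t0 T * s \<in> segm_near t0 T r \<longleftrightarrow> s \<in> {0<..<r}"
proof (cases "T > ereal t0")
  case True
  then obtain u where u: "ereal t0 < ereal u" "ereal u < T"
    using ereal_dense2 by blast
  have "ereal (t0 + s) < T" if "s < u - t0" for s
    using that by (intro less_trans[OF _ u(2)]) simp
  then show ?thesis
    using u True by (intro exI[of _ "u - t0"])
      (auto simp: direction_def segm_near_def segm_def einterval_def min_def max_def)
next
  case False
  then have lt: "T < ereal t0" using T by auto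
  then obtain u where u: "T < ereal u" "ereal u < ereal t0"
    using ereal_dense2 by blast
  have "T < ereal (t0 - s)" if "s < t0 - u" for s
    using that by (intro less_trans[OF u(1)]) simp
  then show ?thesis
    using u lt False by (intro exI[of _ "t0 - u"])
      (auto simp: direction_def segm_near_def segm_def einterval_def min_def max_def)
qed

lemma set_integral_segm_near:
  fixes f :: "real \<Rightarrow> complex"
  assumes "\<And>s. t0 + direction t0 T * s \<in> segm_near t0 T r \<longleftrightarrow> s \<in> {0<..<r}"
  shows "(LINT t:segm_near t0 T r|lborel. f t) = (LINT s:{0<..<r}|lborel. f (t0 + direction t0 T * s))"
proof -
  have "(LINT t:segm_near t0 T r|lborel. f t) =
      \<bar>direction t0 T\<bar> *\<^sub>R (LINT s|lborel. indicat_real (segm_near t0 T r) (t0 + direction t0 T * s) *\<^sub>R f (t0 + direction t0 T * s))"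
    unfolding set_lebesgue_integral_def
    by (rule lborel_integral_real_affine) (use direction_cases[of t0 T] in auto)
  also have "\<bar>direction t0 T\<bar> = 1"
    using direction_cases[of t0 T] by auto
  finally show ?thesis
    using assms by (simp add: set_lebesgue_integral_def indicator_def)
qed

text \<open>
  With \<open>\<epsilon> = exp (\<i> * \<omega>) = \<plusminus>1\<close>, the chain rule contributes \<open>\<epsilon> ^ n\<close>, the amplitude
  \<open>exp (\<i> * \<alpha>0 * \<omega>)\<close>, and the branch of the power \<open>exp (- \<i> * \<chi>\<^sub>n * \<beta>0 * \<omega>)\<close>. Since
  \<open>\<beta>0 * \<chi>\<^sub>n = \<alpha>0 + 1 + n\<close>, the product is \<open>\<epsilon> ^ n / \<epsilon> ^ (n + 1) = \<epsilon>\<close>.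
\<close>

lemma c_coeff_eq_reflected:
  assumes F: "factorization t0 T a \<psi> R \<alpha>0 \<beta>0 q p" and T: "T \<noteq> ereal t0"
  defines "\<epsilon> \<equiv> of_real (direction t0 T) :: complex"
  shows "(deriv ^^ n) (\<lambda>w. (q (of_real t0 + \<epsilon> * w) * exp (\<i> * \<alpha>0 * of_real (omega t0 T))) *
        exp (- chi \<alpha>0 \<beta>0 n * Ln (p (of_real t0 + \<epsilon> * w) * cis (\<beta>0 * omega t0 T)))) 0 / fact n / of_real \<beta>0
    = exp (\<i> * of_real (omega t0 T)) * c_coeff t0 T R \<alpha>0 \<beta>0 q p n"
proof -
  define \<omega> where "\<omega> = (of_real (omega t0 T) :: complex)"
  define \<zeta> where "\<zeta> = chi \<alpha>0 \<beta>0 n"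
  have \<beta>0: "\<beta>0 > 0" and R: "R > 0" using F by (auto simp: factorization_def)
  \<comment> \<open>near \<open>t0\<close> this is \<open>q / p powr \<zeta>\<close> without its constant phase factor\<close>
  define f where "f v = q v * exp (- \<zeta> * Ln (p v * cis (\<beta>0 * omega t0 T)))" for v
  have an: "p analytic_on {of_real t0}" "q analytic_on {of_real t0}"
    using F by (auto simp: factorization_def elim: analytic_on_subset)
  have "p (of_real t0) * cis (\<beta>0 * omega t0 T) \<notin> \<real>\<^sub>\<le>\<^sub>0"
    using rotated_factor_positive[OF F T, of t0] by (simp del: of_real_mult)
  then have fan: "f analytic_on {of_real t0}"
    unfolding f_def using an by (intro analytic_intros) auto
  then obtain e where e: "e > 0" "f holomorphic_on ball (of_real t0) e"
    by (auto simp: analytic_on_def)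
  have \<epsilon>: "\<epsilon> = 1 \<or> \<epsilon> = -1" using direction_cases[of t0 T] by (auto simp: \<epsilon>_def)
  have exp_\<omega>: "exp (\<i> * \<omega>) = \<epsilon>"
    by (simp add: \<omega>_def \<epsilon>_def exp_omega)
  have "(deriv ^^ n) (\<lambda>w. f (\<epsilon> * w + of_real t0)) 0 = \<epsilon> ^ n * (deriv ^^ n) f (\<epsilon> * 0 + of_real t0)"
  proof (rule higher_deriv_compose_linear'[OF e(2)])
    show "\<epsilon> * w + of_real t0 \<in> ball (of_real t0) e" if "w \<in> ball 0 e" for w
      using that \<epsilon> by (auto simp: dist_norm)
  qed (use e in auto)
  then have shifted: "(deriv ^^ n) (\<lambda>w. f (of_real t0 + \<epsilon> * w)) 0 = \<epsilon> ^ n * (deriv ^^ n) f (of_real t0)"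
    by (simp add: add.commute)
  have fan': "(\<lambda>w. f (of_real t0 + \<epsilon> * w)) analytic_on {0}"
    by (rule analytic_on_compose_gen[of "\<lambda>w. of_real t0 + \<epsilon> * w" "{0}" f "{of_real t0}", unfolded o_def])
       (use fan in \<open>auto intro!: analytic_intros\<close>)
  have lhs: "(deriv ^^ n) (\<lambda>w. (q (of_real t0 + \<epsilon> * w) * exp (\<i> * \<alpha>0 * \<omega>)) *
        exp (- \<zeta> * Ln (p (of_real t0 + \<epsilon> * w) * cis (\<beta>0 * omega t0 T)))) 0
      = exp (\<i> * \<alpha>0 * \<omega>) * (\<epsilon> ^ n * (deriv ^^ n) f (of_real t0))"
  proof -
    have "(\<lambda>w. (q (of_real t0 + \<epsilon> * w) * exp (\<i> * \<alpha>0 * \<omega>)) *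
        exp (- \<zeta> * Ln (p (of_real t0 + \<epsilon> * w) * cis (\<beta>0 * omega t0 T))))
      = (\<lambda>w. exp (\<i> * \<alpha>0 * \<omega>) * f (of_real t0 + \<epsilon> * w))"
      by (simp add: f_def mult_ac)
    then show ?thesis
      using higher_deriv_cmult'[OF fan'] shifted by simp
  qed
  have "\<forall>\<^sub>F w in nhds (of_real t0). q w / p_power t0 T R \<beta>0 p \<zeta> w = exp (\<i> * \<zeta> * of_real \<beta>0 * \<omega>) * f w"
    using p_power_germ[OF F T, of \<zeta>]
  proof eventually_elim
    case (elim w)
    then show ?case
      by (simp add: f_def \<omega>_def exp_minus divide_inverse mult_ac)
  qed
  then have "(deriv ^^ n) (\<lambda>w. q w / p_power t0 T R \<beta>0 p \<zeta> w) (of_real t0)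
      = (deriv ^^ n) (\<lambda>w. exp (\<i> * \<zeta> * of_real \<beta>0 * \<omega>) * f w) (of_real t0)"
    by (rule higher_deriv_cong_ev) simp
  also have "\<dots> = exp (\<i> * \<zeta> * of_real \<beta>0 * \<omega>) * (deriv ^^ n) f (of_real t0)"
    by (rule higher_deriv_cmult'[OF fan])
  finally have rhs: "c_coeff t0 T R \<alpha>0 \<beta>0 q p n
      = 1 / of_real \<beta>0 * (1 / fact n) * (exp (\<i> * \<zeta> * of_real \<beta>0 * \<omega>) * (deriv ^^ n) f (of_real t0))"
    by (simp add: c_coeff_def \<zeta>_def)
  have "\<i> * \<zeta> * of_real \<beta>0 * \<omega> = \<i> * \<alpha>0 * \<omega> + of_nat (n + 1) * (\<i> * \<omega>)"
    using \<beta>0 by (simp add: \<zeta>_def chi_def field_simps)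
  then have "exp (\<i> * \<omega>) * exp (\<i> * \<zeta> * of_real \<beta>0 * \<omega>) = exp (\<i> * \<alpha>0 * \<omega>) * \<epsilon> ^ (n + 2)"
    by (simp only: exp_add exp_of_nat_mult exp_\<omega>) simp
  also have "\<epsilon> ^ (n + 2) = \<epsilon> ^ n" using \<epsilon> by auto
  finally have "exp (\<i> * \<omega>) * exp (\<i> * \<zeta> * of_real \<beta>0 * \<omega>) = exp (\<i> * \<alpha>0 * \<omega>) * \<epsilon> ^ n" .
  then have "exp (\<i> * \<omega>) * c_coeff t0 T R \<alpha>0 \<beta>0 q p n
      = exp (\<i> * \<alpha>0 * \<omega>) * \<epsilon> ^ n * (deriv ^^ n) f (of_real t0) / fact n / of_real \<beta>0"
    unfolding rhs by (simp add: mult_ac)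
  then show ?thesis
    using lhs by (simp add: \<omega>_def \<zeta>_def mult.assoc)
qed

section \<open>The asymptotic expansion\<close>

lemma open_segm_near: "open (segm_near t0 T r)"
proof -
  have "segm_near t0 T r = segm t0 T \<inter> ball t0 r"
    by (auto simp: segm_near_def dist_real_def)
  then show ?thesis by (simp add: open_segm open_Int)
qed

text \<open>
  The segment is split at a distance \<open>\<delta>\<close> from \<open>t0\<close>, where \<open>\<delta>\<close> depends on the number \<open>N\<close> of terms.
  The near part is expanded with an error of the order of the term of index \<open>N\<close>, that is
  \<open>(ln l) powr (- Re \<chi>\<^sub>N)\<close>, which is smaller than the last term kept by the factor
  \<open>(ln l) powr (- 1 / \<beta>0)\<close>.
\<close>

theorem corollary4p1p3:
  fixes t0 \<phi>_t0 \<beta>0 R :: real and T \<phi>_T :: ereal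
    and \<phi> \<psi> :: "real \<Rightarrow> real" and a :: "real \<Rightarrow> complex"
    and \<alpha>0 :: complex and q p :: "complex \<Rightarrow> complex"
  defines "P \<equiv> segm t0 T"
  assumes "T \<noteq> ereal t0"
    and "continuous_on P \<phi>" and "\<forall>t\<in>P. \<phi> t > 0"
    and "continuous_on P a"
    and "(\<phi> \<longlongrightarrow> \<phi>_t0) (tending_within (ereal t0) P)"
    and "((\<lambda>t. ereal (\<phi> t)) \<longlongrightarrow> \<phi>_T) (tending_within T P)"
    and "\<phi>_t0 \<ge> 0" and "\<forall>t\<in>P. \<phi> t > \<phi>_t0" and "\<phi>_T > ereal \<phi>_t0"
    and "\<exists>l0\<ge>0. set_integrable lborel P (\<lambda>t. exp (- l0 * \<phi> t) * cmod (a t))"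
    and "\<forall>t\<in>P. \<psi> t = inverse (- ln (1 - exp (- \<phi> t)))"
    and "factorization t0 T a \<psi> R \<alpha>0 \<beta>0 q p"
  shows "asymp_expansion
     (\<lambda>l. LINT t:P|lborel. of_real (exp (- l * \<phi> t)) * a t)
     (\<lambda>n l. mellin_beta (chi \<alpha>0 \<beta>0 n) (l - 1))
     (\<lambda>n. exp (\<i> * of_real (omega t0 T)) * c_coeff t0 T R \<alpha>0 \<beta>0 q p n)"
  unfolding asymp_expansion_def
proof (intro allI impI)
  fix N :: nat assume N: "N \<ge> 1"
  note T = assms(2) and F = assms(13)
  have \<phi>: "continuous_on P \<phi>" "\<And>t. t \<in> P \<Longrightarrow> \<phi> t > 0" and a: "continuous_on P a"
    using assms(3-5) by auto
  have \<alpha>0: "Re \<alpha>0 > -1" and \<beta>0: "\<beta>0 > 0" and R: "R > 0"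
    using F by (auto simp: factorization_def)
  obtain l0 where l0: "set_integrable lborel P (\<lambda>t. exp (- l0 * \<phi> t) * cmod (a t))"
    using assms(11) by auto
  define \<epsilon> where "\<epsilon> = direction t0 T"
  have \<epsilon>: "\<epsilon> = 1 \<or> \<epsilon> = -1"
    unfolding \<epsilon>_def by (rule direction_cases)
  define \<theta> where "\<theta> = \<beta>0 * omega t0 T"
  define h where "h w = Ln (p (of_real t0 + of_real \<epsilon> * w) * cis \<theta>)" for w
  define q' where "q' w = q (of_real t0 + of_real \<epsilon> * w) * exp (\<i> * \<alpha>0 * of_real (omega t0 T))" for w
  note pos = rotated_factor_positive[OF F T, folded \<theta>_def]
  have shift: "(\<lambda>w. g (of_real t0 + of_real \<epsilon> * w)) analytic_on {0}"
    if "g analytic_on {of_real t0}" for g :: "complex \<Rightarrow> complex"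
    by (rule analytic_on_compose_gen[of "\<lambda>w. of_real t0 + of_real \<epsilon> * w" "{0}" g "{of_real t0}", unfolded o_def])
       (use that in \<open>auto intro!: analytic_intros\<close>)
  have an: "p analytic_on {of_real t0}" "q analytic_on {of_real t0}"
    using F by (auto simp: factorization_def elim: analytic_on_subset)
  have q': "q' analytic_on {0}"
    unfolding q'_def by (intro analytic_intros shift an)
  have "p (of_real t0) * cis \<theta> \<notin> \<real>\<^sub>\<le>\<^sub>0"
    using pos[of t0] by (simp del: of_real_mult)
  then have h: "h analytic_on {0}"
    unfolding h_def using an by (intro shift analytic_intros) auto
  obtain \<rho> where \<rho>: "\<rho> > 0" "\<And>r s. r \<le> \<rho> \<Longrightarrow> t0 + \<epsilon> * s \<in> segm_near t0 T r \<longleftrightarrow> s \<in> {0<..<r}"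
    using segm_near_eq_image[OF T] unfolding \<epsilon>_def by blast
  define \<delta>0 where "\<delta>0 = min \<rho> R"
  have \<delta>0: "\<delta>0 > 0" "\<delta>0 \<le> \<rho>" "\<delta>0 \<le> R"
    using \<rho> R by (auto simp: \<delta>0_def)
  have near: "h (of_real s) = of_real (ln (cmod (p (of_real (t0 + \<epsilon> * s)))))"
    "a (t0 + \<epsilon> * s) = of_real s powr \<alpha>0 * q' (of_real s)"
    "\<psi> (t0 + \<epsilon> * s) = s powr \<beta>0 * exp (Re (h (of_real s)))"
    "t0 + \<epsilon> * s \<in> P"
    if s: "0 < s" "s < \<delta>0" for s
  proof -
    define t where "t = t0 + \<epsilon> * s"
    have "t \<in> segm_near t0 T \<delta>0"
      using \<rho>(2)[OF \<delta>0(2), of s] s by (simp add: t_def)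
    then have t: "t \<in> segm_near t0 T R" and tP: "t \<in> P"
      using \<delta>0 by (auto simp: segm_near_def P_def)
    then have at: "a t = segm_power t0 T \<alpha>0 t * q (of_real t)"
      and \<psi>t: "of_real (\<psi> t) = segm_power t0 T (of_real \<beta>0) t * p (of_real t)"
      using F by (auto simp: factorization_def)
    have ts: "\<bar>t - t0\<bar> = s" "of_real t0 + of_real \<epsilon> * of_real s = (of_real t :: complex)"
      using \<epsilon> s by (auto simp: t_def)
    note pt = pos[of t]
    show h_eq: "h (of_real s) = of_real (ln (cmod (p (of_real (t0 + \<epsilon> * s)))))"
      using pt t by (simp add: h_def ts Ln_of_real flip: t_def)
    show "a (t0 + \<epsilon> * s) = of_real s powr \<alpha>0 * q' (of_real s)"
      using at by (simp add: q'_def ts segm_power_def flip: t_def)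
    have "of_real (\<psi> t) = of_real (s powr \<beta>0) * (p (of_real t) * cis \<theta>)"
      unfolding \<psi>t using s by (simp add: segm_power_def ts powr_of_real cis_conv_exp \<theta>_def mult_ac)
    also have "\<dots> = of_real (s powr \<beta>0 * cmod (p (of_real t)))"
      using pt t by simp
    finally have "\<psi> t = s powr \<beta>0 * cmod (p (of_real t))"
      by (simp only: of_real_eq_iff)
    then show "\<psi> (t0 + \<epsilon> * s) = s powr \<beta>0 * exp (Re (h (of_real s)))"
      using pt t by (simp add: h_eq flip: t_def)
    show "t0 + \<epsilon> * s \<in> P"
      using tP by (simp add: t_def)
  qed
  define c where "c n = exp (\<i> * of_real (omega t0 T)) * c_coeff t0 T R \<alpha>0 \<beta>0 q p n" for n
  have coeff: "(deriv ^^ n) (\<lambda>w. q' w * exp (- chi \<alpha>0 \<beta>0 n * h w)) 0 / fact n / of_real \<beta>0 = c n" for n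
    unfolding c_def q'_def h_def \<epsilon>_def \<theta>_def by (rule c_coeff_eq_reflected[OF F T])
  have real: "h (of_real s) \<in> \<real>" if "0 < s" "s < \<delta>0" for s
    using near(1)[OF that] by simp
  let ?G = "\<lambda>\<sigma> l. of_real (ln l powr (- \<sigma>)) :: complex"
  let ?I = "\<lambda>X l. LINT t:X|lborel. of_real (exp (- l * \<phi> t)) * a t"
  obtain \<delta> where \<delta>: "\<delta> > 0" "\<delta> \<le> \<delta>0" and local:
    "(\<lambda>l. (LINT s:{0<..<\<delta>}|lborel. of_real ((1 - exp (- inverse (s powr \<beta>0 * exp (Re (h (of_real s)))))) powr l)
          * (of_real s powr \<alpha>0 * q' (of_real s))) - (\<Sum>n<N. c n * mellin_beta (chi \<alpha>0 \<beta>0 n) (l - 1)))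
      \<in> O[at_top](?G (Re (chi \<alpha>0 \<beta>0 N)))"
    using local_integral_expansion[OF \<alpha>0 \<beta>0 h q' \<delta>0(1) real, of N] unfolding coeff by blast
  have near_eq: "(LINT s:{0<..<\<delta>}|lborel. of_real ((1 - exp (- inverse (s powr \<beta>0 * exp (Re (h (of_real s)))))) powr l)
          * (of_real s powr \<alpha>0 * q' (of_real s))) = ?I (segm_near t0 T \<delta>) l" for l
  proof -
    have "?I (segm_near t0 T \<delta>) l = (LINT s:{0<..<\<delta>}|lborel. of_real (exp (- l * \<phi> (t0 + \<epsilon> * s))) * a (t0 + \<epsilon> * s))"
      unfolding \<epsilon>_def using \<rho>(2)[of \<delta>] \<delta> \<delta>0 by (intro set_integral_segm_near) (simp add: \<epsilon>_def)
    also have "\<dots> = (LINT s:{0<..<\<delta>}|lborel. of_real ((1 - exp (- inverse (s powr \<beta>0 * exp (Re (h (of_real s)))))) powr l)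
          * (of_real s powr \<alpha>0 * q' (of_real s)))"
    proof (rule set_lebesgue_integral_cong, simp, intro allI impI)
      fix s assume "s \<in> {0<..<\<delta>}"
      then have s: "0 < s" "s < \<delta>0" using \<delta> by auto
      define t where "t = t0 + \<epsilon> * s"
      have t: "t \<in> P" using near(4)[OF s] by (simp add: t_def)
      have "exp (- inverse (\<psi> t)) = 1 - exp (- \<phi> t)"
        using assms(12) t \<phi>(2)[OF t] by simp
      then have "(1 - exp (- inverse (\<psi> t))) powr l = exp (- l * \<phi> t)"
        by (simp add: powr_def)
      then show "of_real (exp (- l * \<phi> (t0 + \<epsilon> * s))) * a (t0 + \<epsilon> * s)
        = of_real ((1 - exp (- inverse (s powr \<beta>0 * exp (Re (h (of_real s)))))) powr l) * (of_real s powr \<alpha>0 * q' (of_real s))"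
        by (simp only: near(2,3)[OF s, symmetric] t_def)
    qed
    finally show ?thesis by simp
  qed
  have "\<phi>_T > 0"
    using assms(8,10) by (metis ereal_less_eq(5) le_less_trans)
  then obtain m where m: "m > 0" "\<And>t. t \<in> P - segm_near t0 T \<delta> \<Longrightarrow> m \<le> \<phi> t"
    using phase_bounded_below_off_endpoint[OF T \<delta>(1), of \<phi> \<phi>_T] \<phi> assms(7) unfolding P_def by blast
  have sets: "P \<in> sets lborel" "segm_near t0 T \<delta> \<in> sets lborel" and sub: "segm_near t0 T \<delta> \<subseteq> P"
    using open_segm[of t0 T] open_segm_near[of t0 T \<delta>] by (auto simp: P_def segm_near_def)
  have "?I (P - segm_near t0 T \<delta>) \<in> O[at_top](\<lambda>l. of_real (exp (- m * l)))"
    by (rule laplace_integral_bigo_exp[OF set_integrable_subset[OF l0] m(2)]) (use sets in auto)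
  then have far: "?I (P - segm_near t0 T \<delta>) \<in> O[at_top](?G (Re (chi \<alpha>0 \<beta>0 N)))"
    using exp_decay_bigo_ln_powr[OF m(1)] by (rule landau_o.big_trans)
  have int: "set_integrable lborel P (\<lambda>t. of_real (exp (- l * \<phi> t)) * a t)" if "l \<ge> l0" for l
  proof (rule set_integrable_bound[OF l0])
    have "continuous_on P (\<lambda>t. of_real (exp (- l * \<phi> t)) * a t)"
      by (intro continuous_intros \<phi> a)
    then show "set_borel_measurable lborel P (\<lambda>t. of_real (exp (- l * \<phi> t)) * a t)"
      unfolding set_borel_measurable_def using sets by (simp add: borel_measurable_continuous_on_indicator)
    show "AE t in lborel. t \<in> P \<longrightarrow> norm (of_real (exp (- l * \<phi> t)) * a t) \<le> norm (exp (- l0 * \<phi> t) * cmod (a t))"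
      using that \<phi>(2) by (auto simp: norm_mult intro!: always_eventually mult_right_mono)
  qed
  have "\<forall>\<^sub>F l in at_top. ?I (segm_near t0 T \<delta>) l - (\<Sum>n<N. c n * mellin_beta (chi \<alpha>0 \<beta>0 n) (l - 1)) + ?I (P - segm_near t0 T \<delta>) l
      = ?I P l - (\<Sum>n<N. mellin_beta (chi \<alpha>0 \<beta>0 n) (l - 1) * c n)"
    using eventually_ge_at_top[of l0]
  proof eventually_elim
    case (elim l)
    have "?I (segm_near t0 T \<delta> \<union> (P - segm_near t0 T \<delta>)) l = ?I (segm_near t0 T \<delta>) l + ?I (P - segm_near t0 T \<delta>) l"
      using sets sub by (intro set_integral_Un set_integrable_subset[OF int[OF elim]]) auto
    moreover have "segm_near t0 T \<delta> \<union> (P - segm_near t0 T \<delta>) = P" using sub by auto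
    ultimately show ?case by (simp add: mult.commute)
  qed
  then have "(\<lambda>l. ?I P l - (\<Sum>n<N. mellin_beta (chi \<alpha>0 \<beta>0 n) (l - 1) * c n)) \<in> O[at_top](?G (Re (chi \<alpha>0 \<beta>0 N)))"
    using sum_in_bigo(1)[OF local[unfolded near_eq] far] by (rule iffD1[OF landau_o.big.in_cong])
  also have "?G (Re (chi \<alpha>0 \<beta>0 N)) \<in> o[at_top](?G (Re (chi \<alpha>0 \<beta>0 (N - 1))))"
  proof -
    have less: "Re (chi \<alpha>0 \<beta>0 (N - 1)) < Re (chi \<alpha>0 \<beta>0 N)"
      using N \<beta>0 by (simp add: chi_def divide_strict_right_mono of_nat_diff)
    then have "(\<lambda>l. ln l powr (- Re (chi \<alpha>0 \<beta>0 N))) \<in> o[at_top](\<lambda>l. ln l powr (- Re (chi \<alpha>0 \<beta>0 (N - 1))))"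
      by real_asymp
    then show ?thesis
      by (simp add: landau_o.small.of_real_iff)
  qed
  also have "?G (Re (chi \<alpha>0 \<beta>0 (N - 1))) \<in> \<Theta>[at_top](\<lambda>l. mellin_beta (chi \<alpha>0 \<beta>0 (N - 1)) (l - 1))"
    using mellin_beta_bigtheta[OF Re_chi_pos[OF \<alpha>0 \<beta>0]] by (simp add: bigtheta_sym)
  finally show "(\<lambda>l. ?I P l - (\<Sum>n<N. mellin_beta (chi \<alpha>0 \<beta>0 n) (l - 1) *
      (exp (\<i> * of_real (omega t0 T)) * c_coeff t0 T R \<alpha>0 \<beta>0 q p n)))
      \<in> o[at_top](\<lambda>l. mellin_beta (chi \<alpha>0 \<beta>0 (N - 1)) (l - 1))"
    unfolding c_def .
qed

end
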